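(* Let $T\in\mathcal T$ be a piecewise rotation with angle $\alpha=2\pi a$, where $a$ is irrational, and suppose $T$ is not bijective. Let $(p_\ell/q_\ell)_{\ell\in\mathbb N}$ be the sequence of convergents of the continued fraction expansion of $a$, and let $\ell_0\in\mathbb N$ be such that $$\frac{1}{q_{\ell_0}}\left(\left(8+\frac{\pi}{2q_{\ell_0}}\right)N(T)+4|\Delta|\right)<\frac{|\Delta|}{\pi}.$$ Then $$M(T)\le q_{\ell_0}\,N(T)\left(\frac{2}{\pi}q_{\ell_0}+1\right).$$
   Context: Identify $\mathbb R^2$ with $\mathbb C$. Class $\mathcal T$: fix $\alpha\in\mathbb R$ with $e^{i\alpha}\ne1$, $\gamma\in\mathbb R$, and distinct $C_0,C_1\in\mathbb C$. Let $\mathbf D=e^{i\gamma}\mathbb R$ (a line through $0$), let $\mathbf P_0=\{z:\operatorname{Im}(e^{-i\gamma}z)>0\}$ be the open half-plane bounded by $\mathbf D$ containing $ie^{i\gamma}$, and let $\mathbf P_1=\mathbb C\setminus\mathbf P_0$ be the complementary closed half-plane. The associated map $T:\mathbb C\to\mathbb C$ is $T(z)=e^{i\alpha}(z-C_j)+C_j$ if $z\in\mathbf P_j$, $j\in\{0,1\}$; $\mathcal T$ is the set of all such maps. Put $\beta=\arg(C_1-C_0)$ and $\Delta=-2|C_1-C_0|\sin(\alpha/2)\cos(\gamma+\alpha/2-\beta)$. It is known that $T$ is surjective iff $\Delta\ge0$ and injective iff $\Delta\le0$. $N(T)=\sup\{\,\big||T(z)|-|z|\big| : z\in\mathbb C\}$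 (written with triple bars around $T$ in the source). $T$ is globally attractive if there is $M\ge0$ such that for all $L\ge0$, $\limsup_{n\to\infty}\sup_{|z|\le L}|T^n(z)|\le M$. $T$ is globally repulsive if there is $M\ge0$ such that for all $L\ge M$, $\liminf_{n\to\infty}\inf_{|z|\ge L}|T^n(z)|=+\infty$. $M(T)$ denotes the infimum of the real numbers $M\ge 0$ with the corresponding property. (It is known that a surjective non-injective $T\in\mathcal T$ is globally attractive and an injective non-surjective $T\in\mathcal T$ is globally repulsive, so $M(T)$ is the infimum for the attractive property in the first case and for the repulsive property in the second.) *)

theory Defs
  imports "HOL-Analysis.Analysis"
begin

definition upper_half :: "real \<Rightarrow> complex set" where
  "upper_half \<gamma> = {z. Im (cis (- \<gamma>) * z) > 0}"

definition pw_rot :: "real \<Rightarrow> real \<Rightarrow> complex \<Rightarrow> complex \<Rightarrow> complex \<Rightarrow> complex" where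
  "pw_rot \<alpha> \<gamma> C0 C1 z =
     (if z \<in> upper_half \<gamma> then cis \<alpha> * (z - C0) + C0 else cis \<alpha> * (z - C1) + C1)"

definition piecewise_rotation ::
  "real \<Rightarrow> real \<Rightarrow> complex \<Rightarrow> complex \<Rightarrow> (complex \<Rightarrow> complex) \<Rightarrow> bool" where
  "piecewise_rotation \<alpha> \<gamma> C0 C1 T \<longleftrightarrow> cis \<alpha> \<noteq> 1 \<and> C0 \<noteq> C1 \<and> T = pw_rot \<alpha> \<gamma> C0 C1"

definition rot_gap :: "real \<Rightarrow> real \<Rightarrow> complex \<Rightarrow> complex \<Rightarrow> real" where
  "rot_gap \<alpha> \<gamma> C0 C1 =
     - 2 * norm (C1 - C0) * sin (\<alpha> / 2) * cos (\<gamma> + \<alpha> / 2 - Arg (C1 - C0))"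

definition radial_disp :: "(complex \<Rightarrow> complex) \<Rightarrow> real" where
  "radial_disp T = (SUP z. \<bar>norm (T z) - norm z\<bar>)"

text \<open>For piecewise rotations the supremum above is finite, so the real-valued
  supremum is the intended one.\<close>

lemma bdd_above_radial_disp:
  assumes "piecewise_rotation \<alpha> \<gamma> C0 C1 T"
  shows "bdd_above (range (\<lambda>z. \<bar>norm (T z) - norm z\<bar>))"
proof (rule bdd_aboveI2)
  fix z :: complex
  have *: "\<bar>norm (cis \<alpha> * (z - C) + C) - norm z\<bar> \<le> 2 * norm C" for C
  proof -
    have 1: "cis \<alpha> * (z - C) + C = cis \<alpha> * z + (C - cis \<alpha> * C)"
      by (simp add: algebra_simps)
    have 2: "norm (C - cis \<alpha> * C) \<le> 2 * norm C"
      using norm_triangle_ineq4[of C "cis \<alpha> * C"] by (simp add: norm_mult)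
    have "\<bar>norm (cis \<alpha> * z + (C - cis \<alpha> * C)) - norm z\<bar> \<le> norm (C - cis \<alpha> * C)"
      using norm_triangle_ineq3[of "cis \<alpha> * z + (C - cis \<alpha> * C)" "cis \<alpha> * z"]
      by (simp add: norm_mult)
    with 2 show ?thesis
      unfolding 1 by linarith
  qed
  show "\<bar>norm (T z) - norm z\<bar> \<le> 2 * norm C0 + 2 * norm C1"
    using *[of C0] *[of C1] assms norm_ge_zero[of C0] norm_ge_zero[of C1]
    unfolding piecewise_rotation_def pw_rot_def by auto
qed

definition attracting_bound :: "(complex \<Rightarrow> complex) \<Rightarrow> real \<Rightarrow> bool" where
  "attracting_bound T M \<longleftrightarrow> M \<ge> 0 \<and>
     (\<forall>L\<ge>0. limsup (\<lambda>n. SUP z\<in>{z. norm z \<le> L}. ereal (norm ((T ^^ n) z))) \<le> ereal M)"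

definition repelling_bound :: "(complex \<Rightarrow> complex) \<Rightarrow> real \<Rightarrow> bool" where
  "repelling_bound T M \<longleftrightarrow> M \<ge> 0 \<and>
     (\<forall>L\<ge>M. liminf (\<lambda>n. INF z\<in>{z. L \<le> norm z}. ereal (norm ((T ^^ n) z))) = \<infinity>)"

definition globally_attractive :: "(complex \<Rightarrow> complex) \<Rightarrow> bool" where
  "globally_attractive T \<longleftrightarrow> (\<exists>M. attracting_bound T M)"

definition globally_repulsive :: "(complex \<Rightarrow> complex) \<Rightarrow> bool" where
  "globally_repulsive T \<longleftrightarrow> (\<exists>M. repelling_bound T M)"

lemma not_attractive_and_repulsive:
  "\<not> (globally_attractive T \<and> globally_repulsive T)"
proof
  assume "globally_attractive T \<and> globally_repulsive T"
  then obtain M M' where M: "attracting_bound T M" and M': "repelling_bound T M'"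
    unfolding globally_attractive_def globally_repulsive_def by blast
  let ?z = "complex_of_real M'"
  have "M' \<ge> 0" using M' by (simp add: repelling_bound_def)
  then have nz: "norm ?z = M'" by simp
  have "liminf (\<lambda>n. INF z\<in>{z. M' \<le> norm z}. ereal (norm ((T ^^ n) z)))
      \<le> liminf (\<lambda>n. ereal (norm ((T ^^ n) ?z)))"
    by (intro Liminf_mono always_eventually allI INF_lower) (simp only: nz mem_Collect_eq order_refl)
  also have "\<dots> \<le> limsup (\<lambda>n. ereal (norm ((T ^^ n) ?z)))"
    by (simp add: Liminf_le_Limsup)
  also have "\<dots> \<le> limsup (\<lambda>n. SUP z\<in>{z. norm z \<le> M'}. ereal (norm ((T ^^ n) z)))"
    by (intro Limsup_mono always_eventually allI SUP_upper) (simp only: nz mem_Collect_eq order_refl)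
  also have "\<dots> \<le> ereal M"
    using M \<open>M' \<ge> 0\<close> by (simp add: attracting_bound_def)
  finally show False
    using M' by (simp add: repelling_bound_def)
qed

text \<open>The infimum is taken in the extended reals, so an empty set of admissible bounds
  would give \<open>\<infinity>\<close> rather than an unspecified real number.  By the lemma above at most
  one of the two properties can hold, so the case distinction gives neither of them priority.\<close>

definition threshold_radius :: "(complex \<Rightarrow> complex) \<Rightarrow> ereal" where
  "threshold_radius T =
     (if globally_attractive T then INF M\<in>{M. attracting_bound T M}. ereal M
      else INF M\<in>{M. repelling_bound T M}. ereal M)"

text \<open>Regular continued fraction of an irrational \<open>x\<close>: complete quotients, partial
  quotients, and the usual recurrences for the numerators and denominators \<open>p\<^sub>\<ell>, q\<^sub>\<ell>\<close>
  of the convergents, indexed from \<open>p\<^sub>0 / q\<^sub>0 = \<lfloor>x\<rfloor> / 1\<close>.\<close>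

fun cf_rem :: "real \<Rightarrow> nat \<Rightarrow> real" where
  "cf_rem x 0 = x"
| "cf_rem x (Suc n) = 1 / frac (cf_rem x n)"

definition cf_coeff :: "real \<Rightarrow> nat \<Rightarrow> int" where
  "cf_coeff x n = \<lfloor>cf_rem x n\<rfloor>"

fun cf_num :: "real \<Rightarrow> nat \<Rightarrow> int" where
  "cf_num x 0 = cf_coeff x 0"
| "cf_num x (Suc 0) = cf_coeff x 1 * cf_coeff x 0 + 1"
| "cf_num x (Suc (Suc n)) = cf_coeff x (Suc (Suc n)) * cf_num x (Suc n) + cf_num x n"

fun cf_den :: "real \<Rightarrow> nat \<Rightarrow> int" where
  "cf_den x 0 = 1"
| "cf_den x (Suc 0) = cf_coeff x 1"
| "cf_den x (Suc (Suc n)) = cf_coeff x (Suc (Suc n)) * cf_den x (Suc n) + cf_den x n"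

end

theory Submission
  imports Defs
begin

text \<open>
  Write \<open>T z = e\<^sup>i\<^sup>\<alpha> (z + u\<^sub>j)\<close> on the half-plane \<open>j\<close>, with \<open>u\<^sub>j = (e\<^sup>-\<^sup>i\<^sup>\<alpha> - 1) C\<^sub>j\<close>; then \<open>\<bar>u\<^sub>j\<bar> \<le> N\<close>.
  Far away from the origin one step changes the radius by \<open>\<rho> = Re (e\<^sup>-\<^sup>i\<^sup>\<theta> u\<^sub>j)\<close> up to \<open>O(N\<^sup>2 / \<bar>z\<bar>)\<close>,
  where \<open>\<theta>\<close> is the direction of \<open>z\<close>.  With \<open>x = \<theta> - \<gamma>\<close> and the sign \<open>\<sigma>\<close> of the half-plane,
  \<open>\<rho> = m cos (x - \<theta>\<^sub>0) + J \<sigma> cos x - (\<Delta>/2) \<bar>sin x\<bar>\<close>, where \<open>m\<^sup>2 + J\<^sup>2 \<le> N\<^sup>2\<close>.  The first two terms have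
  mean zero, so the mean of \<open>\<rho>\<close> is \<open>- \<Delta> / \<pi>\<close>.

  For a denominator \<open>q\<close> of a convergent of \<open>a\<close>, the directions of \<open>q\<close> successive iterates stay
  within \<open>3/4\<close> of a cell of a regular \<open>q\<close>-gon.  A Denjoy--Koksma argument bounds the three resulting
  sums: each summand is compared with the increment over one cell of a potential that is periodic
  up to a constant, and the increments telescope around the circle.  Under the hypothesis on
  \<open>q\<close> this makes \<open>\<bar>T\<^sup>q z\<bar> - \<bar>z\<bar>\<close> bounded away from zero, with the sign of \<open>- \<Delta>\<close>, as soon as
  \<open>\<bar>z\<bar> \<ge> (2/\<pi>) q\<^sup>2 N\<close>.  The additional \<open>q N\<close> in the bound is the largest possible change of the
  radius during \<open>q\<close> steps.
\<close>

section \<open>Sums over regular grids\<close>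

lemma cos_ge_quadratic: "1 - t\<^sup>2 / 2 \<le> cos t" for t :: real
proof -
  have "sin (t/2) ^ 2 \<le> (t/2)\<^sup>2"
    using abs_sin_x_le_abs_x[of "t/2"] by (simp only: abs_le_square_iff)
  moreover have "cos t = 1 - 2 * sin (t/2) ^ 2"
    using cos_double_sin[of "t/2"] by simp
  ultimately show ?thesis by (simp add: power_divide)
qed

lemma sin_ge_cubic:
  fixes x :: real
  assumes "0 \<le> x"
  shows "x - x ^ 3 / 6 \<le> sin x"
proof -
  have "(\<lambda>t. sin t - t + t^3/6) 0 \<le> (\<lambda>t. sin t - t + t^3/6) x"
  proof (rule DERIV_nonneg_imp_nondecreasing[OF assms])
    fix t :: real
    have "((\<lambda>t. sin t - t + t^3/6) has_real_derivative (cos t - 1 + t\<^sup>2/2)) (at t)"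
      by (auto intro!: derivative_eq_intros simp: field_simps)
    moreover have "0 \<le> cos t - 1 + t\<^sup>2/2" using cos_ge_quadratic[of t] by simp
    ultimately show "\<exists>y. ((\<lambda>t. sin t - t + t^3/6) has_real_derivative y) (at t) \<and> 0 \<le> y" by blast
  qed
  thus ?thesis by simp
qed

lemma abs_cos_diff_le: "\<bar>cos x - cos y\<bar> \<le> \<bar>x - y\<bar>" for x y :: real
proof -
  have "\<bar>cos x - cos y\<bar> = 2 * (\<bar>sin ((x + y) / 2)\<bar> * \<bar>sin ((y - x) / 2)\<bar>)"
    by (simp add: cos_diff_cos abs_mult)
  also have "\<dots> \<le> 2 * (1 * \<bar>(y - x) / 2\<bar>)"
    using abs_sin_x_le_abs_x[of "(y-x)/2"] by (intro mult_left_mono mult_mono) auto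
  finally show ?thesis by simp
qed

lemma abs_sin_diff_le: "\<bar>sin x - sin y\<bar> \<le> \<bar>x - y\<bar>" for x y :: real
  using abs_cos_diff_le[of "pi/2 - x" "pi/2 - y"] by (simp add: cos_diff)

text \<open>As \<open>p\<close> is invertible modulo \<open>q\<close>, the centres run once through
  a regular \<open>q\<close>-gon. Their cells tile the circle, and the increments telescope to the
  growth of \<open>G\<close> over one turn.\<close>

lemma grid_sum:
  fixes G :: "real \<Rightarrow> real" and p :: int and q :: nat
  assumes q: "q > 0" and cop: "coprime p (int q)"
    and per: "\<And>x. G (x + 2 * pi) = G x + K"
  shows "(\<Sum>k<q. G (c + 2 * pi * (real k * of_int p / real q) + pi / real q)
              - G (c + 2 * pi * (real k * of_int p / real q) - pi / real q)) = K"
proof -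
  define g where "g x = G (x + pi / real q) - G (x - pi / real q)" for x
  have g1: "g (x + 2 * pi) = g x" for x
    using per[of "x + pi / real q"] per[of "x - pi / real q"]
    by (simp add: g_def algebra_simps)
  have gn: "g (x + 2 * pi * real n) = g x" for x n
  proof (induction n)
    case (Suc n)
    have "g (x + 2 * pi * real (Suc n)) = g ((x + 2 * pi * real n) + 2 * pi)"
      by (simp add: algebra_simps)
    then show ?case using g1 Suc by simp
  qed simp
  have gi: "g (x + 2 * pi * of_int m) = g x" for x and m :: int
  proof (cases "m \<ge> 0")
    case True
    then show ?thesis using gn[of x "nat m"] by simp
  next
    case False
    then show ?thesis using gn[of "x + 2 * pi * of_int m" "nat (-m)"] by simp
  qed
  define s where "s k = nat ((int k * p) mod int q)" for k
  have bij: "bij_betw s {..<q} {..<q}"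
  proof -
    have "inj_on s {..<q}"
    proof (rule inj_onI)
      fix i j assume ij: "i \<in> {..<q}" "j \<in> {..<q}" "s i = s j"
      then have "(int i * p) mod int q = (int j * p) mod int q"
        using q by (metis (no_types) eq_nat_nat_iff of_nat_0_less_iff pos_mod_sign s_def)
      then have "int q dvd (int i - int j) * p"
        by (simp add: mod_eq_dvd_iff algebra_simps)
      then have "int q dvd int i - int j"
        using cop by (metis coprime_commute coprime_dvd_mult_left_iff)
      then have "int i mod int q = int j mod int q" by (simp add: mod_eq_dvd_iff)
      then show "i = j" using ij by simp
    qed
    moreover have "s ` {..<q} \<subseteq> {..<q}"
      using q by (auto simp: s_def nat_less_iff)
    ultimately show ?thesis
      by (simp add: bij_betw_def card_subset_eq card_image)
  qed
  have "g (c + 2 * pi * (real k * of_int p / real q)) = g (c + 2 * pi * (real (s k) / real q))" for k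
  proof -
    have "int k * p = int q * ((int k * p) div int q) + int (s k)"
      using q by (simp add: s_def)
    then have "real k * of_int p = real q * of_int ((int k * p) div int q) + real (s k)"
      by (metis of_int_add of_int_mult of_int_of_nat_eq)
    then have "c + 2 * pi * (real k * of_int p / real q)
        = c + 2 * pi * (real (s k) / real q) + 2 * pi * of_int ((int k * p) div int q)"
      using q by (simp add: field_simps)
    then show ?thesis using gi by metis
  qed
  then have "(\<Sum>k<q. g (c + 2 * pi * (real k * of_int p / real q)))
      = (\<Sum>k<q. g (c + 2 * pi * (real (s k) / real q)))" by simp
  also have "\<dots> = (\<Sum>i<q. g (c + 2 * pi * (real i / real q)))"
    using sum.reindex_bij_betw[OF bij, of "\<lambda>i. g (c + 2 * pi * (real i / real q))"] .
  also have "\<dots> = (\<Sum>i<q. G (c + 2 * pi * (real (Suc i) / real q) - pi / real q)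
                        - G (c + 2 * pi * (real i / real q) - pi / real q))"
  proof (rule sum.cong[OF refl])
    fix i
    have "c + 2 * pi * (real i / real q) + pi / real q = c + 2 * pi * (real (Suc i) / real q) - pi / real q"
      using q by (simp add: field_simps)
    then show "g (c + 2 * pi * (real i / real q)) = G (c + 2 * pi * (real (Suc i) / real q) - pi / real q)
                        - G (c + 2 * pi * (real i / real q) - pi / real q)"
      unfolding g_def by (simp only:)
  qed
  also have "\<dots> = G (c + 2 * pi * (real q / real q) - pi / real q) - G (c + 2 * pi * (real 0 / real q) - pi / real q)"
    by (rule sum_lessThan_telescope)
  also have "\<dots> = K" using per[of "c - pi / real q"] q by (simp add: algebra_simps)
  finally show ?thesis by (simp add: g_def)
qed

section \<open>Cell-wise bounds\<close>

text \<open>Write \<open>h(x) = \<sigma> cos x\<close> with \<open>\<sigma> = - sgn (sin x)\<close>: a \<open>\<pi>\<close>-periodic sawtooth whose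
  antiderivative is \<open>- \<bar>sin x\<bar>\<close> and which jumps from \<open>1\<close> down to \<open>-1\<close> at multiples of \<open>\<pi>\<close>.
  If \<open>x\<close> lies within \<open>3/4\<close> of a cell (cells have length \<open>2 w\<close>) from the centre \<open>c\<close>, then \<open>h(x)\<close>
  is at most the average over the cell of \<open>c\<close> of \<open>h\<close> with each downward jump delayed by
  \<open>3/4 + 1/2\<close> cells.  Delaying a jump of size \<open>2\<close> by \<open>5/4\<close> cells costs \<open>5/2\<close> per jump, hence the
  constant in the following staircase function.\<close>

definition sawtooth_step :: "real \<Rightarrow> real \<Rightarrow> real" where
  "sawtooth_step w y = 5/2 * of_int \<lfloor>y / pi\<rfloor> + min (5/2) ((y - pi * of_int \<lfloor>y / pi\<rfloor>) / w)"

text \<open>Dividing by \<open>2 * sin w\<close> instead of \<open>2 * w\<close> makes the sine term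
  exact: over a cell with no zero of the sine inside, its increment is the sawtooth at the
  centre.\<close>

definition sawtooth_pot :: "real \<Rightarrow> real \<Rightarrow> real" where
  "sawtooth_pot w y = sawtooth_step w y - \<bar>sin y\<bar> / (2 * sin w)"

lemma pi_le_3_15: "pi \<le> 63/20"
  by (rule order_trans[OF pi_approx(2)]) simp

lemma cos_int_pi: "cos (pi * of_int n) = 1 \<or> cos (pi * of_int n) = -1"
  using sin_cos_squared_add[of "pi * of_int n"] sin_int_times_real
  by (simp add: power2_eq_1_iff)

lemma reduce_mod_pi:
  obtains n :: int where "\<bar>c - pi * of_int n\<bar> \<le> pi / 2"
proof
  have "c - pi * of_int (round (c / pi)) = (c / pi - of_int (round (c / pi))) * pi"
    by (simp add: field_simps)
  then have "\<bar>c - pi * of_int (round (c / pi))\<bar> = \<bar>of_int (round (c / pi)) - c / pi\<bar> * pi"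
    by (simp add: abs_mult abs_minus_commute)
  also have "\<dots> \<le> 1/2 * pi"
    using of_int_round_abs_le[of "c/pi"] by (intro mult_right_mono) auto
  finally show "\<bar>c - pi * of_int (round (c / pi))\<bar> \<le> pi / 2" by simp
qed

lemma sawtooth_pot_shift:
  "sawtooth_pot w (y + pi * of_int n) = sawtooth_pot w y + 5/2 * of_int n"
proof -
  have "\<lfloor>(y + pi * of_int n) / pi\<rfloor> = \<lfloor>y / pi\<rfloor> + n"
    by (simp add: add_divide_distrib)
  moreover have "\<bar>sin (y + pi * of_int n)\<bar> = \<bar>sin y\<bar>"
    using cos_int_pi[of n] by (auto simp: sin_add)
  ultimately show ?thesis
    by (simp add: sawtooth_pot_def sawtooth_step_def algebra_simps)
qed

lemma sawtooth_step_pos: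
  assumes "0 \<le> y" "y < pi"
  shows "sawtooth_step w y = min (5/2) (y / w)"
proof -
  have "\<lfloor>y / pi\<rfloor> = 0" using assms by (simp add: floor_eq_iff)
  then show ?thesis by (simp add: sawtooth_step_def)
qed

lemma sawtooth_step_neg:
  assumes "0 < w" "5/2 * w \<le> y + pi" "y < 0"
  shows "sawtooth_step w y = 0"
proof -
  have "\<lfloor>y / pi\<rfloor> = -1" using assms by (simp add: floor_eq_iff field_simps)
  moreover have "5/2 \<le> (y + pi) / w" using assms by (simp add: field_simps)
  ultimately show ?thesis by (simp add: sawtooth_step_def min_def)
qed

text \<open>For a cell straddling a jump, the sine term contributes sin c cot w and the ramp
  \<open>1 + c / w\<close>. These bounds make them cancel, leaving at least
  \<open>1 - w\<^sup>2\<close>.\<close>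

lemma mul_cot_bound:
  fixes c w :: real
  assumes w: "0 < w" "w \<le> 1" and c: "0 \<le> c" "c \<le> w"
  shows "c / w - w\<^sup>2 \<le> sin c * cos w / sin w" and "sin c * cos w / sin w \<le> c / w"
proof -
  have sw: "0 < sin w" using w pi_gt3 by (intro sin_gt_zero) auto
  have sww: "sin w \<le> w" using w by (intro sin_x_le_x) auto
  have cw: "1 - w\<^sup>2/2 \<le> cos w" by (rule cos_ge_quadratic)
  have w2: "w\<^sup>2 \<le> 1" using w by (simp add: power_le_one)
  have c2: "c\<^sup>2 \<le> w\<^sup>2" using c by (simp add: power_mono)
  have sc: "c * (1 - c\<^sup>2/6) \<le> sin c" using sin_ge_cubic[OF c(1)] 
    by (simp add: algebra_simps power2_eq_square power3_eq_cube)
  have sc0: "0 \<le> sin c" using c w pi_gt3 by (intro sin_ge_zero) auto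
  have "c / w - w\<^sup>2 \<le> c / w * (1 - w\<^sup>2)"
  proof -
    have "c / w \<le> 1" using c w by simp
    then have "c / w * w\<^sup>2 \<le> 1 * w\<^sup>2" by (intro mult_right_mono) auto
    then show ?thesis by (simp add: algebra_simps)
  qed
  also have "\<dots> \<le> c / w * ((1 - c\<^sup>2/6) * (1 - w\<^sup>2/2))"
  proof (rule mult_left_mono)
    have "(1 - c\<^sup>2/6) * (1 - w\<^sup>2/2) = 1 - c\<^sup>2/6 - w\<^sup>2/2 + c\<^sup>2 * w\<^sup>2 / 12"
      by (simp add: algebra_simps)
    moreover have "0 \<le> c\<^sup>2 * w\<^sup>2 / 12" by simp
    ultimately show "1 - w\<^sup>2 \<le> (1 - c\<^sup>2/6) * (1 - w\<^sup>2/2)" using c2 zero_le_power2[of w] by linarith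
    show "0 \<le> c / w" using c w by simp
  qed
  also have "\<dots> = (c * (1 - c\<^sup>2/6)) * (1 - w\<^sup>2/2) / w" by simp
  also have "\<dots> \<le> sin c * cos w / w"
    using sc cw w w2 sc0 by (intro divide_right_mono mult_mono) auto
  also have "\<dots> \<le> sin c * cos w / sin w"
  proof -
    have "0 \<le> cos w" using cw w2 by linarith
    then show ?thesis using sc0 sw sww w by (intro divide_left_mono) auto
  qed
  finally show "c / w - w\<^sup>2 \<le> sin c * cos w / sin w" .
  have tan: "w * cos w \<le> sin w"
  proof -
    have "(\<lambda>t. sin t - t * cos t) 0 \<le> (\<lambda>t. sin t - t * cos t) w"
    proof (rule DERIV_nonneg_imp_nondecreasing[of 0 w])
      fix t assume t: "0 \<le> t" "t \<le> w"
      have "((\<lambda>t. sin t - t * cos t) has_real_derivative (t * sin t)) (at t)"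
        by (auto intro!: derivative_eq_intros simp: field_simps)
      moreover have "0 \<le> t * sin t" using t w pi_gt3 by (intro mult_nonneg_nonneg sin_ge_zero) auto
      ultimately show "\<exists>y. ((\<lambda>t. sin t - t * cos t) has_real_derivative y) (at t) \<and> 0 \<le> y" by blast
    qed (use w in simp)
    then show ?thesis by simp
  qed
  have "sin c * cos w / sin w \<le> c * cos w / sin w"
    using c sw cw w2 by (intro divide_right_mono mult_right_mono sin_x_le_x) auto
  also have "\<dots> \<le> c / w" using mult_left_mono[OF tan c(1)] sw w by (simp add: field_simps)
  finally show "sin c * cos w / sin w \<le> c / w" .
qed

text \<open>Here only the jump at 0 matters. The cases place the cell to its left, across it with
  the centre on either side, and to its right. Across it, the increment alone nearly reaches 1, the
  maximum of the sawtooth.\<close>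

lemma sawtooth_bound_base:
  assumes w: "0 < w" "w \<le> 1/8" and c: "\<bar>c\<bar> \<le> pi/2" and x: "\<bar>x - c\<bar> \<le> 3/2 * w"
    and \<sigma>: "\<sigma> = 1 \<or> \<sigma> = -1" "\<sigma> * sin x \<le> 0"
  shows "\<sigma> * cos x \<le> \<bar>x - c\<bar> + w\<^sup>2 + (sawtooth_pot w (c + w) - sawtooth_pot w (c - w))"
proof -
  have pi3: "3 < pi" by (rule pi_gt3)
  have sw: "0 < sin w" using w pi3 by (intro sin_gt_zero) auto
  have cb: "- (pi/2) \<le> c" "c \<le> pi/2" using c by linarith+
  have xb: "c - 3/2 * w \<le> x" "x \<le> c + 3/2 * w" using x by linarith+
  have le1: "\<sigma> * cos x \<le> 1" using \<sigma>(1) cos_le_one[of x] cos_ge_minus_one[of x] by auto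
  have xpos: "x \<le> 0" if "\<sigma> = 1"
  proof (rule ccontr)
    assume "\<not> x \<le> 0"
    then have "0 < sin x" using cb xb w pi3 by (intro sin_gt_zero; linarith)
    then show False using \<sigma>(2) that by simp
  qed
  have xneg: "x \<ge> 0" if "\<sigma> = -1"
  proof (rule ccontr)
    assume "\<not> x \<ge> 0"
    then have "0 < sin (-x)" using cb xb w pi3 by (intro sin_gt_zero; linarith)
    then show False using \<sigma>(2) that by simp
  qed
  have cosdiff: "\<bar>cos x - cos c\<bar> \<le> \<bar>x - c\<bar>" by (rule abs_cos_diff_le)
  have cc: "0 \<le> cos c" using c by (intro cos_ge_zero) auto
  consider "c < -w" | "-w \<le> c" "c < 0" | "0 \<le> c" "c < w" | "w \<le> c" by linarith
  then show ?thesis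
  proof cases
    case 1
    have "0 \<le> sin (- (c + w))" "0 \<le> sin (- (c - w))"
      using 1 cb w pi3 by (intro sin_ge_zero; linarith)+
    then have "sin (c + w) \<le> 0" "sin (c - w) \<le> 0" unfolding sin_minus by simp_all
    moreover have "sawtooth_step w (c + w) = 0" "sawtooth_step w (c - w) = 0"
      using 1 c w pi3 by (auto intro!: sawtooth_step_neg)
    ultimately have A: "sawtooth_pot w (c + w) - sawtooth_pot w (c - w) = cos c"
      using sw by (simp add: sawtooth_pot_def sin_add sin_diff field_simps)
    show ?thesis
    proof (cases "\<sigma> = 1")
      case True
      show ?thesis unfolding True using A cosdiff zero_le_power2[of w] by linarith
    next
      case False
      then have "\<sigma> = -1" using \<sigma> by auto
      \<comment> \<open>Here \<open>x\<close> is already past the jump, where the sawtooth is at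
        most 0, while the increment is \<open>cos c\<close>.\<close>
      moreover have "0 \<le> cos x" using xneg[OF \<open>\<sigma> = -1\<close>] xb 1 w pi3 by (intro cos_ge_zero; linarith)
      ultimately show ?thesis
        unfolding \<open>\<sigma> = -1\<close> using A cc zero_le_power2[of w] abs_ge_zero[of "x - c"] by linarith
    qed
  next
    case 2
    have s: "sin (c + w) \<ge> 0" "- sin (c - w) \<ge> 0"
      unfolding sin_minus[symmetric] using 2 w pi3 by (intro sin_ge_zero; linarith)+
    have "sawtooth_step w (c + w) = min (5/2) ((c + w)/w)" "sawtooth_step w (c - w) = 0"
      using 2 w pi3 by (auto intro!: sawtooth_step_neg sawtooth_step_pos)
    moreover have "(c + w)/w = 1 + c/w" "c / w \<le> 0" using w 2 by (auto simp: field_simps)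
    ultimately have A: "sawtooth_pot w (c + w) - sawtooth_pot w (c - w) = 1 + c/w + sin (- c) * cos w / sin w"
      using sw s by (simp add: sawtooth_pot_def sin_add sin_diff field_simps)
    have "(-c) / w - w\<^sup>2 \<le> sin (- c) * cos w / sin w" 
      using mul_cot_bound(1)[of w "-c"] 2 w by auto
    then show ?thesis using A le1 by auto
  next
    case 3
    have s: "sin (c + w) \<ge> 0" "- sin (c - w) \<ge> 0"
      unfolding sin_minus[symmetric] using 3 w pi3 by (intro sin_ge_zero; linarith)+
    have "sawtooth_step w (c + w) = min (5/2) ((c + w)/w)" "sawtooth_step w (c - w) = 0"
      using 3 w pi3 by (auto intro!: sawtooth_step_neg sawtooth_step_pos)
    moreover have "(c + w)/w = 1 + c/w" "c / w \<le> 1" using w 3 by (auto simp: field_simps)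
    ultimately have A: "sawtooth_pot w (c + w) - sawtooth_pot w (c - w) = 1 + c/w - sin c * cos w / sin w"
      using sw s by (simp add: sawtooth_pot_def sin_add sin_diff field_simps)
    have "sin c * cos w / sin w \<le> c / w"
      using mul_cot_bound(2)[of w "c"] 3 w by auto
    then show ?thesis using A le1 by (smt (verit) zero_le_power2)
  next
    case 4
    have s: "sin (c + w) \<ge> 0" "sin (c - w) \<ge> 0"
      using 4 c w pi3 sin_ge_zero[of "c + w"] sin_ge_zero[of "c - w"] by auto
    have F: "sawtooth_step w (c + w) = min (5/2) ((c + w)/w)" "sawtooth_step w (c - w) = min (5/2) ((c - w)/w)"
      using 4 c w pi3 by (auto intro!: sawtooth_step_pos)
    have cw: "(c + w)/w = c/w + 1" "(c - w)/w = c/w - 1" using w by (auto simp: field_simps)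
    have A: "sawtooth_pot w (c + w) - sawtooth_pot w (c - w) 
        = min (5/2) (c/w + 1) - min (5/2) (c/w - 1) - cos c"
      unfolding sawtooth_pot_def F cw using sw s by (simp add: sin_add sin_diff field_simps)
    show ?thesis
    proof (cases "\<sigma> = 1")
      case True
      \<comment> \<open>This case needs the height 5/2: the cell is past the jump but
        \<open>x\<close> is not. The ramp is unsaturated on the whole cell and rises by 2, which
        covers \<open>1 + cos c\<close>.\<close>
      then have "c \<le> 3/2 * w" using xpos xb by linarith
      then have "c / w \<le> 3/2" "1 \<le> c / w" using w 4 by (auto simp: field_simps)
      then have "min (5/2) (c/w + 1) - min (5/2) (c/w - 1) = 2" by auto
      then show ?thesis using A le1 cos_le_one[of c] by (smt (verit) zero_le_power2)
    next
      case False
      then have "\<sigma> = -1" using \<sigma> by auto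
      moreover have "min (5/2) (c/w - 1) \<le> min (5/2) (c/w + 1)" by (intro min.mono) auto
      ultimately show ?thesis
        unfolding \<open>\<sigma> = -1\<close> using A cosdiff zero_le_power2[of w] by linarith
    qed
  qed
qed

text \<open>Translation by a multiple of pi multiplies sine and cosine by a common sign, absorbed
  into \<open>\<sigma>\<close>; the constant gained by the potential cancels in the
  increment.\<close>

lemma sawtooth_bound:
  assumes w: "0 < w" "w \<le> 1/8" and x: "\<bar>x - c\<bar> \<le> 3/2 * w"
    and \<sigma>: "\<sigma> = 1 \<or> \<sigma> = -1" "\<sigma> * sin x \<le> 0"
  shows "\<sigma> * cos x \<le> \<bar>x - c\<bar> + w\<^sup>2 + (sawtooth_pot w (c + w) - sawtooth_pot w (c - w))"
proof -
  obtain n :: int where n: "\<bar>c - pi * of_int n\<bar> \<le> pi/2" by (rule reduce_mod_pi)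
  define c' x' \<sigma>' where "c' = c - pi * of_int n" and "x' = x - pi * of_int n"
    and "\<sigma>' = cos (pi * of_int n) * \<sigma>"
  have e: "cos (pi * of_int n) = 1 \<or> cos (pi * of_int n) = -1" by (rule cos_int_pi)
  have c': "\<bar>c'\<bar> \<le> pi/2" using n by (simp add: c'_def)
  have x': "\<bar>x' - c'\<bar> \<le> 3/2 * w" "\<bar>x' - c'\<bar> = \<bar>x - c\<bar>" using x by (auto simp: x'_def c'_def)
  have tr: "\<sigma>' * sin x' = \<sigma> * sin x" "\<sigma>' * cos x' = \<sigma> * cos x"
    using e by (auto simp: \<sigma>'_def x'_def sin_diff cos_diff)
  have "\<sigma>' = 1 \<or> \<sigma>' = -1" using e \<sigma> by (auto simp: \<sigma>'_def)
  from sawtooth_bound_base[OF w c' x'(1) this] \<sigma> 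
  have "\<sigma> * cos x \<le> \<bar>x - c\<bar> + w\<^sup>2 + (sawtooth_pot w (c' + w) - sawtooth_pot w (c' - w))"
    unfolding tr x'(2) by blast
  moreover have "sawtooth_pot w (c + w) = sawtooth_pot w (c' + w) + 5/2 * of_int n"
    using sawtooth_pot_shift[of w "c' + w" n] by (simp add: c'_def algebra_simps)
  moreover have "sawtooth_pot w (c - w) = sawtooth_pot w (c' - w) + 5/2 * of_int n"
    using sawtooth_pot_shift[of w "c' - w" n] by (simp add: c'_def algebra_simps)
  ultimately show ?thesis by simp
qed

text \<open>A continuous antiderivative of \<open>\<bar>sin y\<bar>\<close>.\<close>

definition arch_pot :: "real \<Rightarrow> real" where
  "arch_pot y = 2 * of_int \<lfloor>y / pi\<rfloor> + 1 - cos (y - pi * of_int \<lfloor>y / pi\<rfloor>)"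

lemma arch_pot_shift: "arch_pot (y + pi * of_int n) = arch_pot y + 2 * of_int n"
proof -
  have "\<lfloor>(y + pi * of_int n) / pi\<rfloor> = \<lfloor>y / pi\<rfloor> + n"
    by (simp add: add_divide_distrib)
  then show ?thesis by (simp add: arch_pot_def algebra_simps)
qed

lemma arch_pot_pos: "0 \<le> y \<Longrightarrow> y < pi \<Longrightarrow> arch_pot y = 1 - cos y"
  and arch_pot_neg: "- pi \<le> y \<Longrightarrow> y < 0 \<Longrightarrow> arch_pot y = cos y - 1"
proof -
  assume "0 \<le> y" "y < pi"
  then have "\<lfloor>y / pi\<rfloor> = 0" by (simp add: floor_eq_iff)
  then show "arch_pot y = 1 - cos y" by (simp add: arch_pot_def)
next
  assume "- pi \<le> y" "y < 0"
  then have "\<lfloor>y / pi\<rfloor> = -1" by (simp add: floor_eq_iff field_simps)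
  then show "arch_pot y = cos y - 1" by (simp add: arch_pot_def)
qed

text \<open>Away from 0 the quotient equals |sin c|. A cell around 0 exceeds it by (1 - cos (w -
  |c|)) / sin w, which is at most \<open>w\<close>.\<close>

lemma arch_bound_base:
  assumes w: "0 < w" "w \<le> 1" and c: "\<bar>c\<bar> \<le> pi/2"
  shows "(arch_pot (c + w) - arch_pot (c - w)) / (2 * sin w) - w \<le> \<bar>sin c\<bar>"
proof -
  have pi3: "3 < pi" by (rule pi_gt3)
  have sw: "0 < sin w" using w pi3 by (intro sin_gt_zero) auto
  consider "c < -w" | "\<bar>c\<bar> \<le> w" "c < w" | "w \<le> c" by linarith
  then show ?thesis
  proof cases
    case 1
    then have "arch_pot (c + w) = cos (c + w) - 1" "arch_pot (c - w) = cos (c - w) - 1"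
      using c w pi3 by (auto intro!: arch_pot_neg)
    then have "arch_pot (c + w) - arch_pot (c - w) = - sin c * (2 * sin w)"
      by (simp add: cos_add cos_diff)
    moreover have "sin c \<le> 0" using sin_ge_zero[of "-c"] 1 c w by auto
    ultimately show ?thesis using sw w by simp
  next
    case 3
    then have "arch_pot (c + w) = 1 - cos (c + w)" "arch_pot (c - w) = 1 - cos (c - w)"
      using c w pi3 by (auto intro!: arch_pot_pos)
    then have "arch_pot (c + w) - arch_pot (c - w) = sin c * (2 * sin w)"
      by (simp add: cos_add cos_diff)
    moreover have "sin c \<ge> 0" using sin_ge_zero[of "c"] 3 c w by auto
    ultimately show ?thesis using sw w by simp
  next
    case 2
    have "arch_pot (c + w) = 1 - cos (c + w)" "arch_pot (c - w) = cos (c - w) - 1"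
      using 2 c w pi3 by (auto intro!: arch_pot_pos arch_pot_neg)
    then have A: "(arch_pot (c + w) - arch_pot (c - w)) / (2 * sin w) = (1 - cos c * cos w) / sin w"
      by (simp add: cos_add cos_diff diff_divide_distrib add_divide_distrib)
    have "1 - cos (w - \<bar>c\<bar>) \<le> (w - \<bar>c\<bar>)\<^sup>2/2" using cos_ge_quadratic[of "w - \<bar>c\<bar>"] by simp
    also have "\<dots> \<le> w\<^sup>2 / 2" using 2 by (intro divide_right_mono power_mono) auto
    also have "\<dots> \<le> w * sin w"
    proof -
      have "w * (w / 2) \<le> w * sin w"
      proof (rule mult_left_mono)
        have "w\<^sup>2 \<le> 1" using w by (simp add: power_le_one)
        then have "w * (w\<^sup>2/6) \<le> w * (1/2)" using w by (intro mult_left_mono) auto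
        moreover have "w ^ 3 = w * w\<^sup>2" by (simp add: power2_eq_square power3_eq_cube)
        ultimately show "w / 2 \<le> sin w" using sin_ge_cubic[of w] w by linarith
      qed (use w in simp)
      then show ?thesis by (simp add: power2_eq_square)
    qed
    finally have "1 - cos (w - \<bar>c\<bar>) \<le> w * sin w" .
    moreover have "cos (w - \<bar>c\<bar>) = cos c * cos w + \<bar>sin c\<bar> * sin w"
    proof (cases "c \<ge> 0")
      case True
      then have "sin c \<ge> 0" using 2 w pi3 by (intro sin_ge_zero) auto
      then show ?thesis using True by (simp add: cos_diff)
    next
      case False
      then have "sin (-c) \<ge> 0" using 2 w pi3 by (intro sin_ge_zero) auto
      then show ?thesis using False by (simp add: cos_add)
    qed
    ultimately have "1 - cos c * cos w \<le> (\<bar>sin c\<bar> + w) * sin w" by (simp add: algebra_simps)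
    then have "(1 - cos c * cos w) / sin w \<le> \<bar>sin c\<bar> + w" using sw by (simp add: divide_le_eq)
    then show ?thesis using A by simp
  qed
qed

lemma arch_bound:
  assumes w: "0 < w" "w \<le> 1"
  shows "(arch_pot (c + w) - arch_pot (c - w)) / (2 * sin w) - w \<le> \<bar>sin c\<bar>"
proof -
  obtain n :: int where n: "\<bar>c - pi * of_int n\<bar> \<le> pi/2" by (rule reduce_mod_pi)
  define c' where "c' = c - pi * of_int n"
  have c': "\<bar>c'\<bar> \<le> pi/2" using n by (simp add: c'_def)
  have "\<bar>sin c'\<bar> = \<bar>sin c\<bar>"
    using cos_int_pi[of n] by (auto simp: c'_def sin_diff)
  moreover have "arch_pot (c + w) = arch_pot (c' + w) + 2 * of_int n"
    using arch_pot_shift[of "c' + w" n] by (simp add: c'_def algebra_simps)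
  moreover have "arch_pot (c - w) = arch_pot (c' - w) + 2 * of_int n"
    using arch_pot_shift[of "c' - w" n] by (simp add: c'_def algebra_simps)
  ultimately show ?thesis using arch_bound_base[OF w c'] by simp
qed

section \<open>Sums over points near a grid\<close>

text \<open>The tolerance is three quarters of the cell length \<open>2 * pi / q\<close>, and
  \<open>q \<ge> 26\<close> brings the half cell \<open>w\<close> below 1/8. The \<open>x k\<close>
  will be the directions of iterates relative to the dividing line.\<close>

locale near_grid =
  fixes p :: int and q :: nat and c0 :: real and x :: "nat \<Rightarrow> real"
  assumes cop: "coprime p (int q)" and q26: "q \<ge> 26"
    and near: "\<And>k. k < q \<Longrightarrow> \<bar>x k - (c0 + 2 * pi * (real k * of_int p / real q))\<bar> \<le> 3/2 * (pi / real q)"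
begin

abbreviation "c k \<equiv> c0 + 2 * pi * (real k * of_int p / real q)"
abbreviation "w \<equiv> pi / real q"

definition "dev = (\<Sum>k<q. \<bar>x k - c k\<bar>)"

lemma q0: "0 < q" using q26 by simp

lemma w_bounds: "0 < w" "w \<le> 1/8"
proof -
  have "real q \<ge> 26" using q26 by linarith
  then have "pi \<le> real q * (1/8)" using pi_le_3_15 by linarith
  then show "w \<le> 1/8" using q0 by (simp add: field_simps)
qed (use q0 in simp)

lemma sin_w: "0 < sin w" using w_bounds pi_gt3 by (intro sin_gt_zero; linarith)

text \<open>The potential \<open>G\<close> is periodic and reproduces the cosine exactly, so the
  grid sum vanishes and only the deviations remain.\<close>

lemma sum_cos: "\<bar>\<Sum>k<q. cos (x k - \<theta>)\<bar> \<le> dev"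
proof -
  define G where "G y = sin (y - \<theta>) / (2 * sin w)" for y
  have "(\<Sum>k<q. G (c k + w) - G (c k - w)) = 0"
  proof (rule grid_sum[OF q0 cop])
    show "G (y + 2 * pi) = G y + 0" for y
      using sin_periodic[of "y - \<theta>"] by (simp add: G_def algebra_simps)
  qed
  moreover have "G (y + w) - G (y - w) = cos (y - \<theta>)" for y
  proof -
    have "sin (y + w - \<theta>) - sin (y - w - \<theta>) = 2 * sin w * cos (y - \<theta>)"
      using sin_add[of "y - \<theta>" w] sin_diff[of "y - \<theta>" w] by (simp add: algebra_simps)
    then show ?thesis using sin_w by (simp add: G_def diff_divide_distrib[symmetric])
  qed
  ultimately have 0: "(\<Sum>k<q. cos (c k - \<theta>)) = 0" by simp
  have "\<bar>\<Sum>k<q. cos (x k - \<theta>)\<bar> = \<bar>\<Sum>k<q. cos (x k - \<theta>) - cos (c k - \<theta>)\<bar>"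
    using 0 by (simp add: sum_subtractf)
  also have "\<dots> \<le> (\<Sum>k<q. \<bar>cos (x k - \<theta>) - cos (c k - \<theta>)\<bar>)" by (rule sum_abs)
  also have "\<dots> \<le> dev"
    unfolding dev_def
  proof (rule sum_mono)
    fix k
    show "\<bar>cos (x k - \<theta>) - cos (c k - \<theta>)\<bar> \<le> \<bar>x k - c k\<bar>"
      using abs_cos_diff_le[of "x k - \<theta>" "c k - \<theta>"] by simp
  qed
  finally show ?thesis .
qed

lemma sum_sawtooth_le:
  assumes "\<And>k. k < q \<Longrightarrow> \<sigma> k = 1 \<or> \<sigma> k = -1" "\<And>k. k < q \<Longrightarrow> \<sigma> k * sin (x k) \<le> 0"
  shows "(\<Sum>k<q. \<sigma> k * cos (x k)) \<le> 5 + dev + pi\<^sup>2 / real q"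
proof -
  have "(\<Sum>k<q. \<sigma> k * cos (x k))
      \<le> (\<Sum>k<q. \<bar>x k - c k\<bar> + w\<^sup>2 + (sawtooth_pot w (c k + w) - sawtooth_pot w (c k - w)))"
    using assms near w_bounds by (intro sum_mono sawtooth_bound) auto
  also have "\<dots> = dev + real q * w\<^sup>2 + (\<Sum>k<q. sawtooth_pot w (c k + w) - sawtooth_pot w (c k - w))"
    by (simp add: sum.distrib dev_def)
  also have "(\<Sum>k<q. sawtooth_pot w (c k + w) - sawtooth_pot w (c k - w)) = 5"
  proof (rule grid_sum[OF q0 cop])
    \<comment> \<open>A turn contains two jumps, each with a stair of height 5/2.\<close>
    show "sawtooth_pot w (y + 2 * pi) = sawtooth_pot w y + 5" for y
      using sawtooth_pot_shift[of w y 2] by (simp add: mult.commute)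
  qed
  also have "real q * w\<^sup>2 = pi\<^sup>2 / real q" using q0 by (simp add: power2_eq_square)
  finally show ?thesis by simp
qed

text \<open>\<open>arch_pot\<close> grows by 4 per turn, so the grid yields
  \<open>2 / sin w\<close>. The losses \<open>w\<close> per cell add up to pi, and moving from
  centres to points costs \<open>dev\<close>.\<close>

lemma sum_abs_sin: "2 * real q / pi - pi - dev \<le> (\<Sum>k<q. \<bar>sin (x k)\<bar>)"
proof -
  have "(\<Sum>k<q. arch_pot (c k + w) - arch_pot (c k - w)) = 4"
  proof (rule grid_sum[OF q0 cop])
    show "arch_pot (y + 2 * pi) = arch_pot y + 4" for y
      using arch_pot_shift[of y 2] by (simp add: mult.commute)
  qed
  then have "(\<Sum>k<q. (arch_pot (c k + w) - arch_pot (c k - w)) / (2 * sin w)) = 4 / (2 * sin w)"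
    by (simp only: sum_divide_distrib[symmetric])
  then have "(\<Sum>k<q. (arch_pot (c k + w) - arch_pot (c k - w)) / (2 * sin w) - w - \<bar>x k - c k\<bar>)
     = 2 / sin w - pi - dev"
    using q0 by (simp add: sum_subtractf dev_def)
  moreover have "(arch_pot (c k + w) - arch_pot (c k - w)) / (2 * sin w) - w - \<bar>x k - c k\<bar> \<le> \<bar>sin (x k)\<bar>" for k
    using arch_bound[of w "c k"] w_bounds abs_sin_diff_le[of "x k" "c k"] by linarith
  ultimately have "2 / sin w - pi - dev \<le> (\<Sum>k<q. \<bar>sin (x k)\<bar>)"
    by (metis (no_types, lifting) sum_mono)
  moreover have "2 / w \<le> 2 / sin w"
    using sin_x_le_x[of w] w_bounds(1) sin_w by (intro divide_left_mono mult_pos_pos) linarith+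
  ultimately show ?thesis by simp
qed

text \<open>Negating \<open>x\<close>, \<open>p\<close> and \<open>\<sigma>\<close> preserves the
  hypotheses and reverses the sign of the sum, so the one-sided bound serves twice.\<close>

lemma sum_sawtooth_abs:
  assumes "\<And>k. k < q \<Longrightarrow> \<sigma> k = 1 \<or> \<sigma> k = -1" "\<And>k. k < q \<Longrightarrow> \<sigma> k * sin (x k) \<le> 0"
  shows "\<bar>\<Sum>k<q. \<sigma> k * cos (x k)\<bar> \<le> 5 + dev + pi\<^sup>2 / real q"
proof -
  interpret r: near_grid "-p" q "-c0" "\<lambda>k. - x k"
  proof
    show "\<bar>- x k - (- c0 + 2 * pi * (real k * of_int (- p) / real q))\<bar> \<le> 3/2 * (pi / real q)" if "k < q" for k
      using near[OF that] by (simp add: abs_if split: if_splits)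
  qed (use cop q26 in auto)
  have d: "r.dev = dev"
    unfolding r.dev_def dev_def by (intro sum.cong refl) (simp add: abs_if)
  have "(\<Sum>k<q. - \<sigma> k * cos (- x k)) \<le> 5 + dev + pi\<^sup>2 / real q"
    unfolding d[symmetric]
  proof (rule r.sum_sawtooth_le)
    fix k assume "k < q"
    then show "- \<sigma> k = 1 \<or> - \<sigma> k = -1" "- \<sigma> k * sin (- x k) \<le> 0" using assms[of k] by auto
  qed
  then show ?thesis using sum_sawtooth_le[OF assms] by (simp add: sum_negf abs_le_iff)
qed

end

section \<open>Convergents\<close>

text \<open>Consecutive convergents have determinant 1 or -1, hence coprimality. Expressing
  \<open>a\<close> by a complete quotient \<open>r > 1\<close> gives the error 1 / (Q (Q r +
  Q')).\<close>

lemma cf_approx: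
  fixes a :: real
  assumes "a \<notin> \<rat>"
  shows "cf_den a n \<ge> 1" and "coprime (cf_num a n) (cf_den a n)"
    and "\<bar>a - of_int (cf_num a n) / of_int (cf_den a n)\<bar> \<le> 1 / (of_int (cf_den a n))\<^sup>2"
proof -
  have irr: "cf_rem a n \<notin> \<rat>" for n
  proof (induction n)
    case (Suc n)
    have "frac (cf_rem a n) \<notin> \<rat>"
      using Suc by (metis Rats_add Rats_of_int add.commute diff_add_cancel frac_def)
    then show ?case
      by (metis Rats_inverse cf_rem.simps(2) inverse_eq_divide inverse_inverse_eq)
  qed (use assms in simp)
  have f: "0 < frac (cf_rem a n)" "frac (cf_rem a n) < 1" for n
  proof -
    have "cf_rem a n \<notin> \<int>" using irr[of n] Ints_subset_Rats by blast
    then show "0 < frac (cf_rem a n)" by (simp add: frac_gt_0_iff)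
  qed (simp add: frac_lt_1)
  have rem1: "cf_rem a (Suc n) > 1" for n using f[of n] by simp
  have coef: "cf_coeff a (Suc n) \<ge> 1" for n
    using rem1[of n] unfolding cf_coeff_def by linarith
  have split: "cf_rem a n = of_int (cf_coeff a n) + 1 / cf_rem a (Suc n)" for n
    by (simp add: cf_coeff_def frac_def)
  have den: "cf_den a n \<ge> 1 \<and> cf_den a (Suc n) \<ge> 1" for n
  proof (induction n)
    case 0 then show ?case using coef[of 0] by simp
  next
    case (Suc n)
    have "cf_coeff a (Suc (Suc n)) * cf_den a (Suc n) \<ge> 0"
      using coef[of "Suc n"] Suc by simp
    then show ?case using Suc by simp
  qed
  then show d1: "cf_den a n \<ge> 1" for n by blast
  have det: "cf_num a (Suc n) * cf_den a n - cf_num a n * cf_den a (Suc n) = (-1) ^ n" for n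
    by (induction n) (simp_all add: algebra_simps)
  show "coprime (cf_num a n) (cf_den a n)"
  proof (rule coprimeI)
    fix d assume "d dvd cf_num a n" "d dvd cf_den a n"
    then have "d dvd (-1) ^ n" unfolding det[of n, symmetric] by simp
    then show "is_unit d" by (meson dvd_trans is_unit_power_iff dvd_minus_iff dvd_refl minus_dvd_iff)
  qed
  \<comment> \<open>\<open>a\<close> is the Moebius image of the complete quotient of index
    \<open>n + 2\<close> under two successive convergents, cleared of denominators.\<close>
  have rep: "a * (of_int (cf_den a (Suc n)) * cf_rem a (Suc (Suc n)) + of_int (cf_den a n))
           = of_int (cf_num a (Suc n)) * cf_rem a (Suc (Suc n)) + of_int (cf_num a n)" for n
  proof (induction n)
    case 0
    define r where "r = cf_rem a (Suc (Suc 0))"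
    have r: "r > 1" using rem1 r_def by blast
    have 1: "a = of_int (cf_coeff a 0) + 1 / cf_rem a (Suc 0)" using split[of 0] by simp
    have 2: "cf_rem a (Suc 0) = of_int (cf_coeff a (Suc 0)) + 1 / r" using split[of "Suc 0"] r_def by simp
    have 3: "cf_rem a (Suc 0) > 1" using rem1 by blast
    have "(a - of_int (cf_coeff a 0)) * cf_rem a (Suc 0) = 1" 
    proof -
      have "a - of_int (cf_coeff a 0) = 1 / cf_rem a (Suc 0)" using 1 by linarith
      then show ?thesis using 3 by (simp del: cf_rem.simps)
    qed
    moreover have "cf_rem a (Suc 0) * r = of_int (cf_coeff a (Suc 0)) * r + 1"
      using 2 r by (simp add: field_simps)
    ultimately have "(a - of_int (cf_coeff a 0)) * (of_int (cf_coeff a (Suc 0)) * r + 1) = r"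
      by (metis mult.assoc mult_1)
    then show ?case by (simp add: r_def[symmetric] algebra_simps del: cf_rem.simps)
  next
    case (Suc n)
    define r where "r = cf_rem a (Suc (Suc (Suc n)))"
    have r: "r > 1" using rem1 r_def by blast
    have 2: "cf_rem a (Suc (Suc n)) = of_int (cf_coeff a (Suc (Suc n))) + 1 / r"
      using split[of "Suc (Suc n)"] r_def by simp
    then have 3: "cf_rem a (Suc (Suc n)) * r = of_int (cf_coeff a (Suc (Suc n))) * r + 1"
      using r by (simp add: field_simps)
    have "a * (of_int (cf_den a (Suc n)) * (cf_rem a (Suc (Suc n)) * r) + of_int (cf_den a n) * r)
        = of_int (cf_num a (Suc n)) * (cf_rem a (Suc (Suc n)) * r) + of_int (cf_num a n) * r"
      using arg_cong[OF Suc, of "\<lambda>t. t * r"] by (simp add: algebra_simps del: cf_rem.simps)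
    then show ?case unfolding 3
      by (simp add: r_def[symmetric] algebra_simps del: cf_rem.simps)
  qed
  show "\<bar>a - of_int (cf_num a n) / of_int (cf_den a n)\<bar> \<le> 1 / (of_int (cf_den a n))\<^sup>2"
  proof (cases n)
    \<comment> \<open>\<open>rep\<close> yields the error of the later of its two convergents, so
      index 0, with denominator 1, is separate.\<close>
    case 0
    have "\<bar>a - of_int \<lfloor>a\<rfloor>\<bar> \<le> 1" by linarith
    then show ?thesis using 0 by (simp add: cf_coeff_def)
  next
    case (Suc m)
    define P Q P' Q' r where "P = real_of_int (cf_num a (Suc m))" and "Q = real_of_int (cf_den a (Suc m))"
      and "P' = real_of_int (cf_num a m)" and "Q' = real_of_int (cf_den a m)" and "r = cf_rem a (Suc (Suc m))"
    have r: "r > 1" using rem1 r_def by blast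
    have Q: "Q \<ge> 1" "Q' \<ge> 1" using d1 by (simp_all add: Q_def Q'_def del: cf_den.simps)
    have e: "a * (Q * r + Q') = P * r + P'" using rep[of m] by (simp only: P_def Q_def P'_def Q'_def r_def)
    have d: "P * Q' - P' * Q = (-1) ^ m"
      using arg_cong[OF det[of m], of real_of_int]
      by (simp only: P_def Q_def P'_def Q'_def of_int_diff of_int_mult of_int_power of_int_minus of_int_1)
    have pos: "Q * r + Q' \<ge> Q" using Q r mult_left_mono[of 1 r Q] by linarith
    have "(a * Q - P) * (Q * r + Q') = - (P * Q' - P' * Q)" using e by algebra
    then have "\<bar>a * Q - P\<bar> * (Q * r + Q') = 1"
      using d pos Q by (simp add: abs_mult[symmetric] power_abs) (metis abs_mult abs_of_nonneg abs_minus_cancel abs_neg_one power_abs power_one order_trans zero_le_one)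
    then have "\<bar>a * Q - P\<bar> * Q \<le> 1" using pos mult_left_mono[OF pos, of "\<bar>a * Q - P\<bar>"] by simp
    moreover have "\<bar>a - P / Q\<bar> = \<bar>a * Q - P\<bar> / Q"
    proof -
      have "a - P / Q = (a * Q - P) / Q" using Q by (simp add: field_simps)
      then show ?thesis using Q by simp
    qed
    ultimately have "\<bar>a - P / Q\<bar> \<le> 1 / Q\<^sup>2"
      using Q by (simp add: field_simps power2_eq_square)
    then show ?thesis using Suc by (simp only: P_def Q_def)
  qed
qed

section \<open>The radial drift\<close>

text \<open>The line through 0 and \<open>v\<close> has distance |sin \<delta>| from 1, so |sin
  \<delta>| is at most \<open>s\<close>, which is at most \<open>sin (s + s ^ 3)\<close>. A positive
  real part confines \<delta> to where the sine increases.\<close>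

lemma polar_of_near_one:
  fixes v :: complex
  assumes "norm (v - 1) \<le> s" "s \<le> 1/2"
  obtains \<delta> where "v = of_real (norm v) * cis \<delta>" "\<bar>\<delta>\<bar> \<le> s + s ^ 3"
proof -
  define \<delta> where "\<delta> = Arg v"
  have s0: "0 \<le> s" using assms(1) norm_ge_zero order_trans by blast
  have v: "v = of_real (norm v) * cis \<delta>"
    by (metis \<delta>_def cis_conv_exp rcis_cmod_Arg rcis_def)
  have rv: "Re v = norm v * cos \<delta>" and iv: "Im v = norm v * sin \<delta>"
    by (subst (1) v, simp)+
  have "(norm (v - 1))\<^sup>2 = (norm v * cos \<delta> - 1)\<^sup>2 + (norm v * sin \<delta>)\<^sup>2"
    by (simp add: cmod_power2 rv iv)
  also have "\<dots> = (norm v - cos \<delta>)\<^sup>2 + (sin \<delta>)\<^sup>2"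
    using sin_cos_squared_add[of \<delta>] by algebra
  finally have "(sin \<delta>)\<^sup>2 \<le> (norm (v - 1))\<^sup>2" by simp
  then have "\<bar>sin \<delta>\<bar> \<le> norm (v - 1)" by (metis abs_le_square_iff abs_norm_cancel)
  then have sd: "\<bar>sin \<delta>\<bar> \<le> s" using assms(1) by linarith
  have "\<bar>Re (v - 1)\<bar> \<le> s" using abs_Re_le_cmod[of "v - 1"] assms(1) by linarith
  then have "0 < norm v * cos \<delta>" using assms(2) rv by simp
  then have cpos: "0 < cos \<delta>" by (simp add: zero_less_mult_iff)
  have \<delta>pi: "\<bar>\<delta>\<bar> \<le> pi" using Arg_bounded[of v] by (simp add: \<delta>_def abs_le_iff)
  have half: "\<bar>\<delta>\<bar> < pi/2"
  proof (rule ccontr)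
    assume "\<not> \<bar>\<delta>\<bar> < pi/2"
    then have "cos \<bar>\<delta>\<bar> \<le> cos (pi/2)" using \<delta>pi by (intro cos_monotone_0_pi_le) auto
    then show False using cpos by simp
  qed
  define \<tau> where "\<tau> = s + s ^ 3"
  have s3: "s ^ 3 \<le> s * (1/4)"
  proof -
    have "s * s\<^sup>2 \<le> s * (1/2)\<^sup>2" using assms(2) s0 by (intro mult_left_mono power_mono) auto
    then show ?thesis by (simp add: power2_eq_square power3_eq_cube)
  qed
  have \<tau>0: "0 \<le> \<tau>" "\<tau> \<le> s * (5/4)" using s0 s3 by (auto simp: \<tau>_def)
  have "\<tau> ^ 3 \<le> (s * (5/4)) ^ 3" using \<tau>0 by (intro power_mono) auto
  also have "\<dots> = s ^ 3 * (125/64)" by (simp add: power_mult_distrib power_divide)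
  also have "\<dots> \<le> s ^ 3 * 6" using s0 by (intro mult_left_mono) auto
  finally have "\<tau> - \<tau> ^ 3 / 6 \<ge> s" by (simp add: \<tau>_def)
  then have "s \<le> sin \<tau>" using sin_ge_cubic[OF \<tau>0(1)] by linarith
  have "\<bar>\<delta>\<bar> \<le> \<tau>"
  proof (rule ccontr)
    assume "\<not> \<bar>\<delta>\<bar> \<le> \<tau>"
    then have "sin \<tau> < sin \<bar>\<delta>\<bar>" using half \<tau>0 by (intro sin_monotone_2pi) auto
    also have "sin \<bar>\<delta>\<bar> \<le> \<bar>sin \<delta>\<bar>" by (simp add: abs_if)
    finally show False using sd \<open>s \<le> sin \<tau>\<close> by linarith
  qed
  then show ?thesis using that v \<tau>_def by blast
qed

text \<open>The component along \<open>e\<close> never exceeds the norm, so the lower bound has no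
  error term. The upper bound completes the square, with
  \<open>2 * r * h = N\<^sup>2\<close>.\<close>

lemma norm_add_first_order:
  fixes z u e :: complex
  assumes "z = of_real (norm z) * e" "norm e = 1" "norm u \<le> N" "N < norm z"
  shows "Re (cnj e * u) \<le> norm (z + u) - norm z"
    and "norm (z + u) - norm z \<le> Re (cnj e * u) + N\<^sup>2 / (2 * norm z)"
proof -
  define r where "r = norm z"
  define \<rho> where "\<rho> = Re (cnj e * u)"
  have ee: "cnj e * e = 1" using assms(2) by (metis complex_norm_square mult.commute of_real_1 one_power2)
  have e: "cnj e * (z + u) = of_real r + cnj e * u"
  proof -
    have "cnj e * z = of_real r * (cnj e * e)" by (subst assms(1)) (simp add: r_def)
    then show ?thesis by (simp only: distrib_left ee mult_1_right)
  qed
  have n: "norm (z + u) = norm (of_real r + cnj e * u)"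
    by (metis assms(2) complex_mod_cnj e mult_1 norm_mult)
  show "Re (cnj e * u) \<le> norm (z + u) - norm z"
    using complex_Re_le_cmod[of "of_real r + cnj e * u"] n by (simp add: r_def)
  have nu: "norm (cnj e * u) = norm u" using assms(2) by (simp add: norm_mult)
  have \<rho>: "\<bar>\<rho>\<bar> \<le> N" using abs_Re_le_cmod[of "cnj e * u"] nu assms(3) by (simp add: \<rho>_def)
  have r: "0 < r" "N < r" using assms(3,4) norm_ge_zero[of u] r_def by linarith+
  define h where "h = N\<^sup>2 / (2 * r)"
  have h: "0 \<le> h" "2 * r * h = N\<^sup>2" using r by (auto simp: h_def)
  have "(norm (z + u))\<^sup>2 = r\<^sup>2 + 2 * r * \<rho> + (norm (cnj e * u))\<^sup>2"
    unfolding n cmod_power2 by (simp add: \<rho>_def power2_eq_square algebra_simps)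
  also have "\<dots> \<le> r\<^sup>2 + 2 * r * \<rho> + N\<^sup>2" using assms(3) nu by (simp add: power_mono)
  also have "\<dots> = (r + \<rho> + h)\<^sup>2 - (\<rho> + h)\<^sup>2" unfolding h(2)[symmetric] by (simp add: power2_eq_square algebra_simps)
  also have "\<dots> \<le> (r + \<rho> + h)\<^sup>2" by simp
  finally have "norm (z + u) \<le> r + \<rho> + h"
    by (rule power2_le_imp_le) (use \<rho> r h in linarith)
  then show "norm (z + u) - norm z \<le> Re (cnj e * u) + N\<^sup>2 / (2 * norm z)"
    by (simp add: r_def \<rho>_def h_def)
qed

text \<open>Induction goes by two because removing both end terms recentres the sum.\<close>

lemma sum_abs_centered: "(\<Sum>k<q. \<bar>real k - (real q - 1) / 2\<bar>) \<le> (real q)\<^sup>2 / 4"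
proof (induction q rule: induct_nat_012)
  case (ge2 n)
  define t where "t = (real n + 1) / 2"
  have "(\<Sum>k<Suc (Suc n). \<bar>real k - (real (Suc (Suc n)) - 1) / 2\<bar>) = (\<Sum>k<Suc (Suc n). \<bar>real k - t\<bar>)"
    by (simp add: t_def add.commute)
  also have "\<dots> = (\<Sum>k<Suc n. \<bar>real k - t\<bar>) + t"
  proof -
    have "\<bar>real (Suc n) - t\<bar> = t" by (simp add: t_def field_simps)
    then show ?thesis by (subst sum.lessThan_Suc) (simp only:)
  qed
  also have "(\<Sum>k<Suc n. \<bar>real k - t\<bar>) = (\<Sum>k<n. \<bar>real (Suc k) - t\<bar>) + t"
    by (subst sum.lessThan_Suc_shift) (simp add: t_def)
  also have "(\<Sum>k<n. \<bar>real (Suc k) - t\<bar>) = (\<Sum>k<n. \<bar>real k - (real n - 1) / 2\<bar>)"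
    by (intro sum.cong refl) (simp add: t_def field_simps)
  finally show ?case using ge2(1) by (simp add: t_def power2_eq_square field_simps)
qed auto

text \<open>The weights are the later bound 12/5 on the total deviation and 5 + 12/5; their
  Euclidean norm, the root of 1513/25, is below 8.\<close>

lemma cauchy_schwarz_bound:
  fixes m j N :: real
  assumes "m\<^sup>2 + j\<^sup>2 \<le> N\<^sup>2" "0 \<le> N"
  shows "12/5 * m + 37/5 * j \<le> 8 * N"
proof (rule power2_le_imp_le)
  have "(12/5 * m + 37/5 * j)\<^sup>2 + (37/5 * m - 12/5 * j)\<^sup>2 = (1513/25) * (m\<^sup>2 + j\<^sup>2)"
    by (simp add: power2_eq_square algebra_simps)
  moreover have "0 \<le> (37/5 * m - 12/5 * j)\<^sup>2" by simp
  ultimately have "(12/5 * m + 37/5 * j)\<^sup>2 \<le> (1513/25) * (m\<^sup>2 + j\<^sup>2)" by linarith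
  also have "\<dots> \<le> 64 * N\<^sup>2" using assms(1) by (intro mult_mono) auto
  finally show "(12/5 * m + 37/5 * j)\<^sup>2 \<le> (8 * N)\<^sup>2" by (simp add: power_mult_distrib)
qed (use assms in simp)

text \<open>\<open>large\<close> is the hypothesis on the convergent multiplied by \<open>q\<close>.
  \<open>\<Delta>\<close> appears as the component of \<open>u1 - u0\<close> normal to the dividing
  line, the form in which it enters the drift.\<close>

locale rotation_orbit =
  fixes T :: "complex \<Rightarrow> complex" and \<alpha> \<gamma> :: real and u0 u1 :: complex and N :: real
    and p :: int and q :: nat and \<Delta> :: real
  assumes T: "T z = cis \<alpha> * (z + (if z \<in> upper_half \<gamma> then u0 else u1))"
    and u0: "norm u0 \<le> N" and u1: "norm u1 \<le> N" and N: "0 < N"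
    and cop: "coprime p (int q)" and q0: "0 < q"
    and conv: "\<bar>\<alpha> / (2 * pi) - of_int p / real q\<bar> \<le> 1 / (real q)\<^sup>2"
    and \<Delta>: "\<Delta> = Im (cis (- \<gamma>) * (u1 - u0))"
    and large: "(8 + pi / (2 * real q)) * N + 4 * \<bar>\<Delta>\<bar> < real q * \<bar>\<Delta>\<bar> / pi"
begin

definition "gain = real q * \<bar>\<Delta>\<bar> / pi - ((8 + pi / (2 * real q)) * N + 4 * \<bar>\<Delta>\<bar>)"

text \<open>The radius beyond which \<open>q\<close> successive steps turn the direction of a point, relative to the
  exact rotation, by at most a quarter of the cell \<open>2 \<pi> / q\<close>.\<close>

definition "R0 = 2 * (real q)\<^sup>2 * N / pi"

abbreviation "u z \<equiv> (if z \<in> upper_half \<gamma> then u0 else u1)"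

lemma gain_pos: "0 < gain" using large by (simp add: gain_def)

lemma \<Delta>_bounds: "0 < \<bar>\<Delta>\<bar>" "\<bar>\<Delta>\<bar> \<le> 2 * N" "8 * N + 4 * \<bar>\<Delta>\<bar> < real q * \<bar>\<Delta>\<bar> / pi"
proof -
  have "0 \<le> pi / (2 * real q) * N" using N by simp
  then show 1: "8 * N + 4 * \<bar>\<Delta>\<bar> < real q * \<bar>\<Delta>\<bar> / pi" using large by (simp add: distrib_right)
  show "\<bar>\<Delta>\<bar> \<le> 2 * N"
    using abs_Im_le_cmod[of "cis (- \<gamma>) * (u1 - u0)"] norm_triangle_ineq4[of u1 u0] u0 u1
    by (simp add: \<Delta> norm_mult)
  show "0 < \<bar>\<Delta>\<bar>" using 1 N by (cases "\<Delta> = 0") auto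
qed

lemma q26: "26 \<le> q"
proof -
  \<comment> \<open>\<open>8 * N\<close> is at least \<open>4 * \<bar>\<Delta>\<bar>\<close>, which
    leads to q > 8 pi > 25.\<close>
  have "8 * \<bar>\<Delta>\<bar> < real q * \<bar>\<Delta>\<bar> / pi" using \<Delta>_bounds by linarith
  then have "(8 * pi) * \<bar>\<Delta>\<bar> < real q * \<bar>\<Delta>\<bar>" by (simp add: field_simps)
  then have "8 * pi < real q" using \<Delta>_bounds(1) by (simp only: mult_less_cancel_right_pos)
  moreover have "25 < 8 * pi" using pi_approx(1) by simp
  ultimately have "real 25 < real q" by simp
  then show ?thesis by linarith
qed

lemma q26r: "26 \<le> real q" using q26 by linarith

section \<open>Radii and angles along an orbit\<close>

lemma norm_T: "norm (T z) = norm (z + u z)" by (simp add: T norm_mult)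

lemma norm_u: "norm (u z) \<le> N" using u0 u1 by simp

lemma norm_T_diff: "\<bar>norm (T z) - norm z\<bar> \<le> N"
  using norm_triangle_ineq3[of "z + u z" z] norm_u[of z] by (simp add: norm_T)

lemma norm_iter_diff: "\<bar>norm ((T ^^ n) z) - norm z\<bar> \<le> real n * N"
proof (induction n)
  case (Suc n)
  then show ?case using norm_T_diff[of "(T ^^ n) z"] by (simp add: distrib_right)
qed simp

text \<open>Undoing the rotation turns each step into a translation of length at most
  \<open>N\<close>.\<close>

lemma unrotated_iter_diff: "norm (cis (- (real n * \<alpha>)) * (T ^^ n) z - z) \<le> real n * N"
proof (induction n)
  case (Suc n)
  define y where "y = (T ^^ n) z"
  have "cis (- (real (Suc n) * \<alpha>)) * cis \<alpha> = cis (- (real n * \<alpha>))"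
    by (simp add: cis_mult algebra_simps)
  then have "cis (- (real (Suc n) * \<alpha>)) * (T ^^ Suc n) z = cis (- (real n * \<alpha>)) * (y + u y)"
    by (simp only: T y_def funpow.simps comp_apply mult.assoc[symmetric])
  then have "cis (- (real (Suc n) * \<alpha>)) * (T ^^ Suc n) z - z
      = (cis (- (real n * \<alpha>)) * y - z) + cis (- (real n * \<alpha>)) * u y"
    by (simp only: distrib_left) (simp add: algebra_simps)
  then have "norm (cis (- (real (Suc n) * \<alpha>)) * (T ^^ Suc n) z - z)
      \<le> norm (cis (- (real n * \<alpha>)) * y - z) + norm (cis (- (real n * \<alpha>)) * u y)"
    by (simp only: norm_triangle_ineq)
  also have "\<dots> \<le> real n * N + N"
    using Suc norm_u[of y] by (intro add_mono) (simp_all only: y_def norm_mult norm_cis mult_1)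
  finally show ?case by (simp add: distrib_right)
qed simp

lemma R0_pos: "0 < R0" using N q0 by (simp add: R0_def)

text \<open>The unrotated iterate divided by \<open>z\<close> is within \<open>k * N / R0\<close> of
  1, and \<open>R0\<close> is chosen so that this equals \<open>s\<close>.\<close>

lemma polar_iter:
  assumes z: "R0 \<le> norm z" and k: "k < q"
  defines "s \<equiv> real k * pi / (2 * (real q)\<^sup>2)"
  shows "\<exists>\<delta>. (T ^^ k) z = of_real (norm ((T ^^ k) z)) * cis (Arg z + real k * \<alpha> + \<delta>) \<and> \<bar>\<delta>\<bar> \<le> s + s ^ 3"
proof -
  define y where "y = cis (- (real k * \<alpha>)) * (T ^^ k) z"
  have nz: "0 < norm z" using R0_pos z by linarith
  have "norm (y / z - 1) = norm (y - z) / norm z"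
    using nz by (simp add: norm_divide[symmetric] diff_divide_distrib)
  also have "\<dots> \<le> real k * N / R0"
    using unrotated_iter_diff[of k z] R0_pos z nz N by (intro frac_le) (auto simp: y_def)
  also have "\<dots> = s" using N q0 by (simp add: R0_def s_def)
  finally have "norm (y / z - 1) \<le> s" .
  moreover have "s \<le> 1/2"
  proof -
    have "real k * pi \<le> real q * real q" using k q26r pi_le_3_15 by (intro mult_mono) auto
    then show ?thesis using q0 by (simp add: s_def power2_eq_square field_simps)
  qed
  ultimately obtain \<delta> where d: "y / z = of_real (norm (y / z)) * cis \<delta>" "\<bar>\<delta>\<bar> \<le> s + s ^ 3"
    by (rule polar_of_near_one)
  have zz: "z = of_real (norm z) * cis (Arg z)" by (metis rcis_cmod_Arg rcis_def)
  have "y = (y / z) * z" using nz by simp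
  also have "\<dots> = (of_real (norm (y / z)) * cis \<delta>) * (of_real (norm z) * cis (Arg z))"
    using d(1) zz by (rule arg_cong2)
  also have "\<dots> = of_real (norm (y / z) * norm z) * (cis (Arg z) * cis \<delta>)" by simp
  also have "norm (y / z) * norm z = norm y" using nz by (simp add: norm_divide)
  finally have y: "y = of_real (norm y) * cis (Arg z + \<delta>)" by (simp add: cis_mult)
  have "norm y = norm ((T ^^ k) z)" by (simp add: y_def norm_mult)
  moreover have "(T ^^ k) z = cis (real k * \<alpha>) * y"
    by (simp add: y_def mult.assoc[symmetric] cis_mult)
  ultimately have "(T ^^ k) z = of_real (norm ((T ^^ k) z)) * (cis (real k * \<alpha>) * cis (Arg z + \<delta>))"
    using y by (metis mult.left_commute)
  then show ?thesis using d(2) by (auto simp: cis_mult algebra_simps)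
qed

text \<open>A block loses at most \<open>q * N\<close>, which is at most half of \<open>R0\<close>.
  This controls the second-order errors within the block.\<close>

lemma norm_iter_lower:
  assumes "R0 \<le> norm z" "k \<le> q"
  shows "(real q)\<^sup>2 * N / pi \<le> norm ((T ^^ k) z)"
proof -
  have "real k * N \<le> real q * N" using assms N by (intro mult_right_mono) auto
  moreover have "real q * N \<le> (real q)\<^sup>2 * N / pi"
  proof -
    have "(real q * N) * pi \<le> (real q * N) * real q" using q26r pi_le_3_15 N by (intro mult_left_mono) auto
    then show ?thesis by (simp add: field_simps power2_eq_square)
  qed
  moreover have "R0 = 2 * ((real q)\<^sup>2 * N / pi)" by (simp add: R0_def)
  ultimately show ?thesis using norm_iter_diff[of k z] assms(1) by linarith
qed

lemma drift:
  assumes z: "R0 \<le> norm z"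
  shows "\<Delta> > 0 \<Longrightarrow> norm ((T ^^ q) z) \<le> norm z - gain"
    and "\<Delta> < 0 \<Longrightarrow> norm z + gain \<le> norm ((T ^^ q) z)"
proof -
  define Z where "Z k = (T ^^ k) z" for k
  \<comment> \<open>\<open>N * \<epsilon>\<close> will bound the second-order errors of all
    \<open>q\<close> steps, whence the term pi / (2 q) in the hypothesis.\<close>
  define \<epsilon> where "\<epsilon> = pi / (2 * real q)"
  define s where "s k = real k * pi / (2 * (real q)\<^sup>2)" for k
  obtain \<delta> where \<delta>: "\<And>k. k < q \<Longrightarrow> Z k = of_real (norm (Z k)) * cis (Arg z + real k * \<alpha> + \<delta> k)"
      "\<And>k. k < q \<Longrightarrow> \<bar>\<delta> k\<bar> \<le> s k + s k ^ 3"
    using polar_iter[OF z] unfolding Z_def s_def by metis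
  define \<psi> where "\<psi> k = Arg z + real k * \<alpha> + \<delta> k - \<gamma>" for k
  define e where "e k = cis (\<gamma> + \<psi> k)" for k
  have Ze: "Z k = of_real (norm (Z k)) * e k" if "k < q" for k
  proof -
    have "\<gamma> + \<psi> k = Arg z + real k * \<alpha> + \<delta> k" by (simp add: \<psi>_def)
    then show ?thesis using \<delta>(1)[OF that] by (simp only: e_def)
  qed
  have Zlow: "(real q)\<^sup>2 * N / pi \<le> norm (Z k)" if "k < q" for k
    using norm_iter_lower[OF z] that by (simp add: Z_def)
  have "N * pi < N * (real q)\<^sup>2"
  proof (rule mult_strict_left_mono[OF _ N])
    have "real q * 1 \<le> real q * real q" using q26r by (intro mult_left_mono) auto
    then show "pi < (real q)\<^sup>2" unfolding power2_eq_square using q26r pi_le_3_15 by linarith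
  qed
  then have Nlow: "N < (real q)\<^sup>2 * N / pi" by (simp add: field_simps)
  have Zpos: "N < norm (Z k)" if "k < q" for k using Zlow[OF that] Nlow by linarith

  define \<eta> where "\<eta> = \<alpha> / (2 * pi) - of_int p / real q"
  \<comment> \<open>The grid is centred: \<open>k \<alpha>\<close> drifts off \<open>2 \<pi> k p / q\<close> linearly in \<open>k\<close>, and shifting the grid by half of
    the total drift halves the sum of the deviations.\<close>
  define c0 where "c0 = Arg z - \<gamma> + pi * \<eta> * (real q - 1)"
  have \<psi>c: "\<psi> k - (c0 + 2 * pi * (real k * of_int p / real q))
      = 2 * pi * \<eta> * (real k - (real q - 1) / 2) + \<delta> k" for k
  proof -
    have "\<alpha> = 2 * pi * \<eta> + 2 * pi * (of_int p / real q)" by (simp add: \<eta>_def field_simps)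
    then have "real k * \<alpha> = 2 * pi * \<eta> * real k + 2 * pi * (real k * of_int p / real q)"
      by (simp add: distrib_left)
    moreover have "2 * pi * \<eta> * (real k - (real q - 1) / 2) = 2 * pi * \<eta> * real k - pi * \<eta> * (real q - 1)"
      by (simp add: right_diff_distrib diff_divide_distrib)
    ultimately show ?thesis unfolding \<psi>_def c0_def by linarith
  qed
  have \<eta>: "\<bar>\<eta>\<bar> \<le> 1 / (real q)\<^sup>2" using conv by (simp add: \<eta>_def)
  have \<psi>c_le: "\<bar>\<psi> k - (c0 + 2 * pi * (real k * of_int p / real q))\<bar>
      \<le> 2 * pi / (real q)\<^sup>2 * \<bar>real k - (real q - 1) / 2\<bar> + \<bar>\<delta> k\<bar>" for k
  proof -
    have "2 * pi * \<bar>\<eta>\<bar> * \<bar>real k - (real q - 1) / 2\<bar> \<le> 2 * pi * (1 / (real q)\<^sup>2) * \<bar>real k - (real q - 1) / 2\<bar>"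
      using \<eta> by (intro mult_right_mono mult_left_mono) auto
    moreover have "\<bar>2 * pi * \<eta> * (real k - (real q - 1) / 2)\<bar> = 2 * pi * \<bar>\<eta>\<bar> * \<bar>real k - (real q - 1) / 2\<bar>"
      by (simp add: abs_mult)
    ultimately show ?thesis unfolding \<psi>c
      using abs_triangle_ineq[of "2 * pi * \<eta> * (real k - (real q - 1) / 2)" "\<delta> k"] by simp
  qed
  \<comment> \<open>The cubic term goes into the factor \<open>1 + 1 / q\<close>, later compensated
    by \<open>k\<close> being at most \<open>q - 1\<close>.\<close>
  have \<delta>_le: "\<bar>\<delta> k\<bar> \<le> s k * (1 + 1 / real q)" if k: "k < q" for k
  proof -
    have s0: "0 \<le> s k" by (simp add: s_def)
    have "s k \<le> \<epsilon>"
    proof -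
      have "real k * pi \<le> real q * pi" using k by (intro mult_right_mono) auto
      then have "s k \<le> real q * pi / (2 * (real q)\<^sup>2)" unfolding s_def by (intro divide_right_mono) auto
      then show ?thesis using q0 by (simp add: \<epsilon>_def power2_eq_square)
    qed
    then have "(s k)\<^sup>2 \<le> \<epsilon>\<^sup>2" using s0 by (intro power_mono)
    also have "\<epsilon>\<^sup>2 \<le> 1 / real q"
    proof -
      have "pi\<^sup>2 \<le> (63/20)\<^sup>2" using pi_le_3_15 by (intro power_mono) auto
      also have "\<dots> \<le> 4 * real q" using q26r by (simp add: power2_eq_square)
      finally have "pi\<^sup>2 / (4 * real q * real q) \<le> 4 * real q / (4 * real q * real q)"
        by (intro divide_right_mono) auto
      then show ?thesis using q0 by (simp add: \<epsilon>_def power2_eq_square)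
    qed
    finally have "s k * (s k)\<^sup>2 \<le> s k * (1 / real q)" using s0 by (intro mult_left_mono)
    moreover have "s k ^ 3 = s k * (s k)\<^sup>2" by (simp add: power2_eq_square power3_eq_cube)
    ultimately show ?thesis using \<delta>(2)[OF k] by (simp add: distrib_left)
  qed
  \<comment> \<open>The rational approximation contributes at most half a cell, the translations at
    most a quarter.\<close>
  interpret g: near_grid p q c0 \<psi>
  proof
    fix k assume k: "k < q"
    have "\<bar>real k - (real q - 1) / 2\<bar> \<le> real q / 2" using k by (simp add: abs_le_iff field_simps)
    then have "2 * pi / (real q)\<^sup>2 * \<bar>real k - (real q - 1) / 2\<bar> \<le> 2 * pi / (real q)\<^sup>2 * (real q / 2)"
      by (intro mult_left_mono) auto
    also have "\<dots> = pi / real q" using q0 by (simp add: power2_eq_square)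
    finally have 1: "2 * pi / (real q)\<^sup>2 * \<bar>real k - (real q - 1) / 2\<bar> \<le> pi / real q" .
    have "s k * (1 + 1 / real q) = pi * (real k * (real q + 1)) / (2 * real q * (real q)\<^sup>2)"
      using q0 by (simp add: s_def field_simps power2_eq_square)
    also have "\<dots> \<le> pi * (real q)\<^sup>2 / (2 * real q * (real q)\<^sup>2)"
    proof (intro divide_right_mono mult_left_mono)
      have "real k * (real q + 1) \<le> (real q - 1) * (real q + 1)" using k by (intro mult_right_mono) auto
      then show "real k * (real q + 1) \<le> (real q)\<^sup>2" by (simp add: power2_eq_square algebra_simps)
    qed auto
    also have "\<dots> = pi / real q / 2" using q0 by simp
    finally have 2: "s k * (1 + 1 / real q) \<le> pi / real q / 2" .
    show "\<bar>\<psi> k - (c0 + 2 * pi * (real k * of_int p / real q))\<bar> \<le> 3/2 * (pi / real q)"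
      using order_trans[OF \<psi>c_le add_mono[OF 1 order_trans[OF \<delta>_le[OF k] 2]]] by simp
  qed (use cop q26 in auto)

  \<comment> \<open>The two contributions sum to at most pi / 2 and pi / 4, and 3 pi / 4 is below
    12/5.\<close>
  have dev: "g.dev \<le> 12/5"
  proof -
    have "g.dev \<le> (\<Sum>k<q. 2 * pi / (real q)\<^sup>2 * \<bar>real k - (real q - 1) / 2\<bar> + s k * (1 + 1 / real q))"
      unfolding g.dev_def by (intro sum_mono order_trans[OF \<psi>c_le] add_left_mono \<delta>_le) simp
    also have "\<dots> = 2 * pi / (real q)\<^sup>2 * (\<Sum>k<q. \<bar>real k - (real q - 1) / 2\<bar>) + (\<Sum>k<q. s k) * (1 + 1 / real q)"
      by (simp only: sum.distrib sum_distrib_left sum_distrib_right)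
    also have "2 * pi / (real q)\<^sup>2 * (\<Sum>k<q. \<bar>real k - (real q - 1) / 2\<bar>) \<le> 2 * pi / (real q)\<^sup>2 * ((real q)\<^sup>2 / 4)"
      by (intro mult_left_mono sum_abs_centered) simp
    also have "\<dots> = pi / 2" using q0 by simp
    also have "(\<Sum>k<q. s k) * (1 + 1 / real q) \<le> pi / 4"
    proof -
      have sk: "(\<Sum>k<n. real k) = real n * (real n - 1) / 2" for n
        by (induction n) (simp_all add: field_simps)
      have "(\<Sum>k<q. s k) = (\<Sum>k<q. real k) * pi / (2 * (real q)\<^sup>2)"
        by (simp only: s_def sum_distrib_right sum_divide_distrib)
      also have "\<dots> * (1 + 1 / real q) = pi / 4 * (((real q)\<^sup>2 - 1) / (real q)\<^sup>2)"
        unfolding sk using q0 by (simp add: field_simps power2_eq_square)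
      also have "\<dots> \<le> pi / 4 * 1" using q0 by (intro mult_left_mono) (auto simp: field_simps)
      finally show ?thesis by simp
    qed
    finally show ?thesis using pi_le_3_15 by simp
  qed

  \<comment> \<open>The dividing line belongs to the closed half-plane, with sign 1; the sine is 0
    there, so \<open>\<sigma>sin\<close> still holds.\<close>
  define \<sigma> :: "nat \<Rightarrow> real" where "\<sigma> k = (if Z k \<in> upper_half \<gamma> then -1 else 1)" for k
  have mem: "Z k \<in> upper_half \<gamma> \<longleftrightarrow> 0 < sin (\<psi> k)" if k: "k < q" for k
  proof -
    have "cis (- \<gamma>) * Z k = of_real (norm (Z k)) * cis (\<psi> k)"
      by (subst Ze[OF k]) (simp add: e_def cis_mult mult.left_commute)
    then have "Im (cis (- \<gamma>) * Z k) = norm (Z k) * sin (\<psi> k)" by simp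
    moreover have "0 < norm (Z k)" using Zpos[OF k] N by linarith
    ultimately show ?thesis unfolding upper_half_def mem_Collect_eq by (auto simp only: zero_less_mult_iff)
  qed
  have \<sigma>: "\<sigma> k = 1 \<or> \<sigma> k = -1" for k by (simp add: \<sigma>_def)
  have \<sigma>sin: "\<sigma> k * sin (\<psi> k) = - \<bar>sin (\<psi> k)\<bar>" if "k < q" for k
    using mem[OF that] by (simp add: \<sigma>_def)

  define v0 v1 where "v0 = cis (- \<gamma>) * u0" and "v1 = cis (- \<gamma>) * u1"
  \<comment> \<open>In the frame of the dividing line, (\<open>A\<close>, \<open>B\<close>) is the
    mean of the two translations and (\<open>J\<close>, \<open>\<Delta> / 2\<close>) half their
    difference, which enters with the sign \<open>\<sigma>\<close>.\<close>
  define A B J where "A = (Re v0 + Re v1) / 2" and "B = (Im v0 + Im v1) / 2" and "J = (Re v1 - Re v0) / 2"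
  define m \<theta> where "m = norm (Complex A B)" and "\<theta> = Arg (Complex A B)"
  have AB: "A = m * cos \<theta>" "B = m * sin \<theta>"
    using rcis_cmod_Arg[of "Complex A B"] unfolding m_def[symmetric] \<theta>_def[symmetric]
    by (auto simp: complex_eq_iff rcis_def)
  have \<Delta>v: "\<Delta> = Im v1 - Im v0" by (simp add: \<Delta> v0_def v1_def algebra_simps)
  \<comment> \<open>The parallelogram identity: this is why the constant \<open>8\<close> suffices, the smooth part and the
    jump part of \<open>\<rho>\<close> cannot both be of size \<open>N\<close>.\<close>
  have mJ: "m\<^sup>2 + \<bar>J\<bar>\<^sup>2 \<le> N\<^sup>2"
  proof -
    have "(norm v0)\<^sup>2 \<le> N\<^sup>2" "(norm v1)\<^sup>2 \<le> N\<^sup>2"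
      using u0 u1 by (auto intro!: power_mono simp: v0_def v1_def norm_mult)
    moreover obtain D where "0 \<le> D" "m\<^sup>2 + J\<^sup>2 + D = (norm v0)\<^sup>2 / 2 + (norm v1)\<^sup>2 / 2"
    proof
      show "m\<^sup>2 + J\<^sup>2 + (\<Delta> / 2)\<^sup>2 = (norm v0)\<^sup>2 / 2 + (norm v1)\<^sup>2 / 2"
        unfolding m_def \<Delta>v cmod_power2 A_def B_def J_def by (simp add: power2_eq_square field_simps)
    qed simp
    ultimately show ?thesis unfolding power2_abs by linarith
  qed
  have JN: "\<bar>J\<bar> \<le> N"
  proof (rule power2_le_imp_le)
    show "\<bar>J\<bar>\<^sup>2 \<le> N\<^sup>2" using mJ zero_le_power2[of m] by linarith
  qed (use N in simp)

  define \<rho> where "\<rho> k = Re (cnj (e k) * u (Z k))" for k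
  have \<rho>: "\<rho> k = m * cos (\<psi> k - \<theta>) + J * (\<sigma> k * cos (\<psi> k)) - \<Delta> / 2 * \<bar>sin (\<psi> k)\<bar>" if k: "k < q" for k
  proof -
    define v where "v = (if Z k \<in> upper_half \<gamma> then v0 else v1)"
    have "cnj (e k) * u (Z k) = cis (- \<psi> k) * v"
      by (simp add: e_def v_def v0_def v1_def cis_cnj cis_mult mult.assoc[symmetric] add.commute)
    then have "\<rho> k = Re v * cos (\<psi> k) + Im v * sin (\<psi> k)" by (simp add: \<rho>_def)
    also have "Re v = A + J * \<sigma> k" by (simp add: v_def A_def J_def \<sigma>_def field_simps)
    also have "Im v = B + \<Delta> / 2 * \<sigma> k" by (simp add: v_def B_def \<Delta>v \<sigma>_def field_simps)
    also have "(A + J * \<sigma> k) * cos (\<psi> k) + (B + \<Delta> / 2 * \<sigma> k) * sin (\<psi> k)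
       = (A * cos (\<psi> k) + B * sin (\<psi> k)) + J * (\<sigma> k * cos (\<psi> k)) + \<Delta> / 2 * (\<sigma> k * sin (\<psi> k))"
      by (simp add: algebra_simps)
    finally show ?thesis unfolding \<sigma>sin[OF k] AB by (simp add: cos_diff algebra_simps)
  qed

  define S where "S = (\<Sum>k<q. \<rho> k)"
  define Sc where "Sc = (\<Sum>k<q. cos (\<psi> k - \<theta>))"
  define Sj where "Sj = (\<Sum>k<q. \<sigma> k * cos (\<psi> k))"
  define Ss where "Ss = (\<Sum>k<q. \<bar>sin (\<psi> k)\<bar>)"
  have S: "S = m * Sc + J * Sj - \<Delta> / 2 * Ss"
    by (simp add: S_def Sc_def Sj_def Ss_def \<rho> sum_distrib_left sum.distrib sum_subtractf)
  have "\<bar>m * Sc\<bar> \<le> m * (12/5)"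
    using g.sum_cos[of \<theta>] dev unfolding abs_mult Sc_def m_def abs_norm_cancel
    by (intro mult_left_mono) auto
  moreover have "\<bar>J * Sj\<bar> \<le> \<bar>J\<bar> * (37/5 + pi\<^sup>2 / real q)"
  proof -
    have "\<bar>Sj\<bar> \<le> 5 + g.dev + pi\<^sup>2 / real q"
      unfolding Sj_def using \<sigma> \<sigma>sin by (intro g.sum_sawtooth_abs) auto
    then show ?thesis unfolding abs_mult using dev by (intro mult_left_mono) auto
  qed
  moreover have "\<bar>J\<bar> * (pi\<^sup>2 / real q) \<le> N * (pi\<^sup>2 / real q)" using JN by (intro mult_right_mono) auto
  moreover have "12/5 * m + 37/5 * \<bar>J\<bar> \<le> 8 * N" using cauchy_schwarz_bound[OF mJ] N by simp
  ultimately have err: "\<bar>m * Sc\<bar> + \<bar>J * Sj\<bar> \<le> 8 * N + N * (pi\<^sup>2 / real q)"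
    by (simp add: distrib_left)
  \<comment> \<open>Of the \<open>4 * \<bar>\<Delta>\<bar>\<close> in \<open>gain\<close>, one
    \<bar>\<Delta>\<bar> pays for this term. The other three pay for the defect pi + 12/5 \<le> 6 of
    \<open>Ss\<close>, weighted by \<bar>\<Delta>\<bar> / 2.\<close>
  have "N * (pi\<^sup>2 / real q) \<le> \<bar>\<Delta>\<bar>"
  proof -
    have "8 * N < real q * \<bar>\<Delta>\<bar> / pi" using \<Delta>_bounds by linarith
    then have "8 * N * pi < real q * \<bar>\<Delta>\<bar>" by (simp add: field_simps)
    moreover have "N * pi * pi \<le> N * pi * 8" using N pi_le_3_15 by (intro mult_left_mono) auto
    ultimately have "N * pi\<^sup>2 \<le> real q * \<bar>\<Delta>\<bar>" by (simp add: power2_eq_square)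
    then show ?thesis using q0 by (simp add: field_simps)
  qed
  moreover have "\<bar>\<Delta>\<bar> / 2 * (2 * real q / pi - 6) \<le> \<bar>\<Delta>\<bar> / 2 * Ss"
    using g.sum_abs_sin dev pi_le_3_15 by (intro mult_left_mono) (auto simp: Ss_def)
  moreover have "\<bar>\<Delta>\<bar> / 2 * (2 * real q / pi - 6) = real q * \<bar>\<Delta>\<bar> / pi - 3 * \<bar>\<Delta>\<bar>"
    by (simp add: field_simps)
  ultimately have main: "\<bar>m * Sc\<bar> + \<bar>J * Sj\<bar> - \<bar>\<Delta>\<bar> / 2 * Ss \<le> - gain - N * \<epsilon>"
    using err by (simp add: gain_def \<epsilon>_def distrib_right)

  have step: "norm (Z (Suc k)) - norm (Z k) \<le> \<rho> k + N * \<epsilon> / real q \<and> \<rho> k \<le> norm (Z (Suc k)) - norm (Z k)"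
    if k: "k < q" for k
  proof -
    have n: "norm (Z (Suc k)) = norm (Z k + u (Z k))" unfolding Z_def by (simp add: norm_T)
    have "norm (e k) = 1" by (simp add: e_def)
    note fo = norm_add_first_order[OF Ze[OF k] this norm_u[of "Z k"] Zpos[OF k]]
    have "0 < norm (Z k)" using Zpos[OF k] N by linarith
    then have "N\<^sup>2 / (2 * norm (Z k)) \<le> N\<^sup>2 / (2 * ((real q)\<^sup>2 * N / pi))"
      using Zlow[OF k] N q0 by (intro divide_left_mono) auto
    also have "\<dots> = N * \<epsilon> / real q" using N q0 by (simp add: \<epsilon>_def power2_eq_square field_simps)
    finally show ?thesis unfolding n \<rho>_def using fo by auto
  qed
  have tel: "(\<Sum>k<q. norm (Z (Suc k)) - norm (Z k)) = norm ((T ^^ q) z) - norm z"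
    using sum_lessThan_telescope[of "\<lambda>k. norm (Z k)" q] by (simp add: Z_def)
  have "(\<Sum>k<q. norm (Z (Suc k)) - norm (Z k)) \<le> (\<Sum>k<q. \<rho> k + N * \<epsilon> / real q)"
    using step by (intro sum_mono) auto
  also have "\<dots> = S + N * \<epsilon>" using q0 by (simp add: S_def sum.distrib)
  finally have up: "norm ((T ^^ q) z) - norm z \<le> S + N * \<epsilon>" unfolding tel .
  have low: "S \<le> norm ((T ^^ q) z) - norm z"
    unfolding tel[symmetric] S_def using step by (intro sum_mono) auto
  show "norm ((T ^^ q) z) \<le> norm z - gain" if "\<Delta> > 0"
    using up main that unfolding S by simp
  have "0 \<le> N * \<epsilon>" using N by (simp add: \<epsilon>_def)
  then show "norm z + gain \<le> norm ((T ^^ q) z)" if "\<Delta> < 0"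
    using low main that unfolding S by simp
qed

section \<open>From the drift over \<open>q\<close> steps to attraction and repulsion\<close>

definition "R = R0 + real q * N"

lemma R_nonneg: "0 \<le> R" using R0_pos N by (simp add: R_def)

lemma norm_iter_short: "k \<le> q \<Longrightarrow> \<bar>norm ((T ^^ k) z) - norm z\<bar> \<le> real q * N"
proof -
  assume "k \<le> q"
  then have "real k * N \<le> real q * N" using N by (intro mult_right_mono) auto
  then show ?thesis using norm_iter_diff[of k z] by linarith
qed

lemma attracting:
  assumes "\<Delta> > 0"
  shows "attracting_bound T R"
  unfolding attracting_bound_def
proof (intro conjI allI impI R_nonneg)
  fix L :: real assume "0 \<le> L"
  \<comment> \<open>\<open>K\<close> losses of \<open>gain\<close> would exhaust any radius up to
    \<open>L\<close>, so within \<open>K\<close> blocks every such orbit enters the disc of radius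
    \<open>R0\<close>.\<close>
  obtain K :: nat where K: "L < real K * gain" using reals_Archimedean3[OF gain_pos] by blast
  \<comment> \<open>Look back \<open>q\<close> steps: from beyond \<open>R0\<close> the block cannot
    increase the radius, already at most \<open>R\<close>; from inside it adds at most
    \<open>q * N\<close>.\<close>
  have trapped: "norm ((T ^^ m) y) \<le> R" if y: "norm y < R0" for y m
  proof (induction m rule: less_induct)
    case (less m)
    show ?case
    proof (cases "m \<le> q")
      case True
      then show ?thesis using norm_iter_short[of m y] y by (simp add: R_def)
    next
      case False
      define x where "x = (T ^^ (m - q)) y"
      have m: "(T ^^ m) y = (T ^^ q) x"
        using False by (simp add: x_def funpow_add[symmetric, THEN fun_cong, simplified])
      show ?thesis
      proof (cases "R0 \<le> norm x")
        case True
        have "norm x \<le> R" unfolding x_def using False q0 by (intro less) auto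
        then show ?thesis unfolding m using drift(1)[OF True assms] gain_pos by linarith
      next
        case False
        then show ?thesis unfolding m using norm_iter_short[of q x] by (simp add: R_def)
      qed
    qed
  qed
  have bound: "norm ((T ^^ n) z) \<le> R" if z: "norm z \<le> L" and n: "K * q \<le> n" for z n
  proof -
    have "\<exists>j\<le>K. norm ((T ^^ (j * q)) z) < R0"
    proof (rule ccontr)
      assume "\<not> ?thesis"
      then have far: "R0 \<le> norm ((T ^^ (j * q)) z)" if "j \<le> K" for j using that by (meson not_le)
      have "norm ((T ^^ (j * q)) z) \<le> L - real j * gain" if "j \<le> K" for j
        using that
      proof (induction j)
        case (Suc j)
        have "(T ^^ (Suc j * q)) z = (T ^^ q) ((T ^^ (j * q)) z)" by (simp add: funpow_add)
        then show ?case using Suc drift(1)[OF far[of j] assms] by (simp add: distrib_right)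
      qed (use z in simp)
      from this[of K] K norm_ge_zero[of "(T ^^ (K * q)) z"] show False by linarith
    qed
    then obtain j where j: "j \<le> K" "norm ((T ^^ (j * q)) z) < R0" by blast
    then have "j * q \<le> n" using n by (meson le_trans mult_le_mono1)
    then have "(T ^^ n) z = (T ^^ (n - j * q)) ((T ^^ (j * q)) z)"
      by (metis add.commute comp_apply funpow_add le_add_diff_inverse)
    then show ?thesis using trapped[OF j(2)] by simp
  qed
  show "limsup (\<lambda>n. SUP z\<in>{z. norm z \<le> L}. ereal (norm ((T ^^ n) z))) \<le> ereal R"
  proof (rule Limsup_bounded)
    show "\<forall>\<^sub>F n in sequentially. (SUP z\<in>{z. norm z \<le> L}. ereal (norm ((T ^^ n) z))) \<le> ereal R"
      using bound by (intro eventually_sequentiallyI[of "K * q"] SUP_least) auto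
  qed
qed

lemma repelling:
  assumes "\<Delta> < 0"
  shows "repelling_bound T R"
  unfolding repelling_bound_def
proof (intro conjI allI impI R_nonneg)
  fix L :: real assume L: "R \<le> L"
  have R0R: "R0 \<le> R" using N by (simp add: R_def)
  have blocks: "norm z + real j * gain \<le> norm ((T ^^ (j * q)) z)" if z: "R \<le> norm z" for z j
  proof (induction j)
    case (Suc j)
    have "0 \<le> real j * gain" using gain_pos by simp
    then have "R0 \<le> norm ((T ^^ (j * q)) z)" using Suc z R0R by linarith
    from drift(2)[OF this assms] Suc show ?case by (simp add: funpow_add distrib_right)
  qed simp
  show "liminf (\<lambda>n. INF z\<in>{z. L \<le> norm z}. ereal (norm ((T ^^ n) z))) = \<infinity>"
  proof (rule ccontr)
    assume "\<not> ?thesis"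
    then obtain b :: real where b: "liminf (\<lambda>n. INF z\<in>{z. L \<le> norm z}. ereal (norm ((T ^^ n) z))) < ereal b"
      by (metis ereal_dense2 ereal_infty_less(1) less_ereal.simps(2))
    \<comment> \<open>The extra \<open>q * N\<close> pays for the incomplete last block of
      \<open>n mod q\<close> steps.\<close>
    obtain K :: nat where K: "b + real q * N < real K * gain" using reals_Archimedean3[OF gain_pos] by blast
    have "ereal b \<le> liminf (\<lambda>n. INF z\<in>{z. L \<le> norm z}. ereal (norm ((T ^^ n) z)))"
    proof (rule Liminf_bounded)
      have "b \<le> norm ((T ^^ n) z)" if n: "K * q \<le> n" and z: "L \<le> norm z" for n z
      proof -
        have "(T ^^ n) z = (T ^^ (n mod q)) ((T ^^ (n div q * q)) z)"
          by (metis add.commute comp_apply div_mult_mod_eq funpow_add)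
        moreover have "n mod q \<le> q" using q0 by (simp add: less_imp_le)
        ultimately have 1: "norm ((T ^^ (n div q * q)) z) - real q * N \<le> norm ((T ^^ n) z)"
          using norm_iter_short[of "n mod q" "(T ^^ (n div q * q)) z"] by simp
        have "K \<le> n div q" using n q0 by (simp add: less_eq_div_iff_mult_less_eq)
        then have "real K * gain \<le> real (n div q) * gain" using gain_pos by (intro mult_right_mono) auto
        then show ?thesis using 1 blocks[of z "n div q"] z L K R_nonneg by linarith
      qed
      then show "\<forall>\<^sub>F n in sequentially. ereal b \<le> (INF z\<in>{z. L \<le> norm z}. ereal (norm ((T ^^ n) z)))"
        by (intro eventually_sequentiallyI[of "K * q"] INF_greatest) auto
    qed
    then show False using b by simp
  qed
qed

text \<open>\<open>threshold_radius\<close> tests attraction first, so for negative \<Delta>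
  attraction is excluded by its incompatibility with repulsion.\<close>

lemma threshold_le: "threshold_radius T \<le> ereal R"
proof (cases "\<Delta> > 0")
  case True
  then have "attracting_bound T R" by (rule attracting)
  then show ?thesis unfolding threshold_radius_def globally_attractive_def by (auto intro: INF_lower)
next
  case False
  then have "\<Delta> < 0" using \<Delta>_bounds(1) by linarith
  then have r: "repelling_bound T R" by (rule repelling)
  then have "\<not> globally_attractive T"
    using not_attractive_and_repulsive[of T] by (auto simp: globally_repulsive_def)
  then show ?thesis unfolding threshold_radius_def using r by (auto intro: INF_lower)
qed

end

section \<open>The parameters of a piecewise rotation\<close>

text \<open>With \<open>w = (cis (- \<alpha>) - 1) * C\<close>, rotation about \<open>C\<close>
  sends \<open>z\<close> to a point of norm |z + w|. Both z = w and z = -w change the radius by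
  exactly |w|, and one of them lies in the closure of the half-plane in question.\<close>

lemma displacement_le_radial_disp:
  assumes T: "piecewise_rotation \<alpha> \<gamma> C0 C1 T"
  shows "norm ((cis (- \<alpha>) - 1) * C0) \<le> radial_disp T"
    and "norm ((cis (- \<alpha>) - 1) * C1) \<le> radial_disp T"
proof -
  have le: "\<bar>norm (T z) - norm z\<bar> \<le> radial_disp T" for z
    unfolding radial_disp_def using bdd_above_radial_disp[OF T] by (intro cSUP_upper) auto
  have rot: "norm (cis \<alpha> * (z - C) + C) = norm (z + (cis (- \<alpha>) - 1) * C)" for z C
  proof -
    have "cis \<alpha> * (z - C) + C = cis \<alpha> * (z + (cis (- \<alpha>) - 1) * C)"
      by (simp add: algebra_simps cis_mult)
    then show ?thesis by (simp add: norm_mult)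
  qed
  have TC: "T z = (if z \<in> upper_half \<gamma> then cis \<alpha> * (z - C0) + C0 else cis \<alpha> * (z - C1) + C1)" for z
    using T by (simp add: piecewise_rotation_def pw_rot_def)
  define h where "h z = Im (cis (- \<gamma>) * z)" for z
  have hneg: "h (- z) = - h z" for z by (simp add: h_def)
  have diff: "\<bar>norm (z + w) - norm z\<bar> = norm w" if "z = w \<or> z = - w" for z w :: complex
    using that by auto
  show "norm ((cis (- \<alpha>) - 1) * C1) \<le> radial_disp T"
  proof -
    define w where "w = (cis (- \<alpha>) - 1) * C1"
    obtain z where z: "z = w \<or> z = - w" "h z \<le> 0"
      using hneg[of w] by (metis linear neg_le_0_iff_le)
    then have "z \<notin> upper_half \<gamma>" by (simp add: upper_half_def h_def)
    then have "norm (T z) = norm (z + w)" by (simp add: TC rot w_def)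
    then show ?thesis using le[of z] diff[OF z(1)] by (simp add: w_def)
  qed
  show "norm ((cis (- \<alpha>) - 1) * C0) \<le> radial_disp T"
  proof -
    define w where "w = (cis (- \<alpha>) - 1) * C0"
    \<comment> \<open>\<open>z\<close> may lie on the boundary line, which is not in the open half-plane, so it is approximated
      from inside.\<close>
    obtain z where z: "z = w \<or> z = - w" "0 \<le> h z"
      using hneg[of w] by (metis linear neg_0_le_iff_le)
    define x where "x n = z + cis (\<gamma> + pi/2) * of_real (inverse (real (Suc n)))" for n
    have "h (z + cis (\<gamma> + pi/2) * of_real t) = h z + t" for t
    proof -
      have "cis (- \<gamma>) * (z + cis (\<gamma> + pi/2) * of_real t) = cis (- \<gamma>) * z + cis (pi/2) * of_real t"
        by (simp only: distrib_left mult.assoc[symmetric] cis_mult) simp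
      then show ?thesis by (simp add: h_def)
    qed
    then have "h (x n) = h z + inverse (real (Suc n))" for n by (simp only: x_def)
    then have "h (x n) > 0" for n using z(2) by (simp add: add_nonneg_pos)
    then have "x n \<in> upper_half \<gamma>" for n by (simp add: upper_half_def h_def)
    then have *: "\<bar>norm (x n + w) - norm (x n)\<bar> \<le> radial_disp T" for n
      using le[of "x n"] by (simp add: TC rot w_def)
    have "x \<longlonglongrightarrow> z + cis (\<gamma> + pi/2) * of_real 0"
      unfolding x_def by (intro tendsto_intros LIMSEQ_inverse_real_of_nat)
    then have "(\<lambda>n. \<bar>norm (x n + w) - norm (x n)\<bar>) \<longlonglongrightarrow> \<bar>norm (z + w) - norm z\<bar>"
      by (intro tendsto_intros) simp_all
    then have "\<bar>norm (z + w) - norm z\<bar> \<le> radial_disp T"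
      by (rule LIMSEQ_le_const2) (use * in auto)
    then show ?thesis using diff[OF z(1)] by (simp add: w_def)
  qed
qed

text \<open>Factor exp(-i \<alpha>) - 1 as -2 i sin(\<alpha>/2) exp(-i \<alpha>/2) and write
  \<open>C1 - C0\<close> in polar form. This identifies \<open>rot_gap\<close> with the normal
  component used in \<open>rotation_orbit\<close>.\<close>

lemma rot_gap_eq:
  "rot_gap \<alpha> \<gamma> C0 C1 = Im (cis (- \<gamma>) * ((cis (- \<alpha>) - 1) * C1 - (cis (- \<alpha>) - 1) * C0))"
proof -
  define r \<beta> where "r = norm (C1 - C0)" and "\<beta> = Arg (C1 - C0)"
  have C: "C1 - C0 = of_real r * cis \<beta>" by (metis r_def \<beta>_def rcis_cmod_Arg rcis_def)
  have "cis (- \<alpha>) - 1 = cis (- \<alpha>/2) * (cis (- \<alpha>/2) - cis (\<alpha>/2))"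
    by (simp add: right_diff_distrib cis_mult)
  also have "cis (- \<alpha>/2) - cis (\<alpha>/2) = of_real (- 2 * sin (\<alpha>/2)) * cis (pi/2)"
    by (simp add: complex_eq_iff)
  finally have "cis (- \<gamma>) * ((cis (- \<alpha>) - 1) * (C1 - C0))
      = of_real (- 2 * r * sin (\<alpha>/2)) * (cis (- \<gamma>) * cis (- \<alpha>/2) * cis (pi/2) * cis \<beta>)"
    by (simp add: C mult_ac)
  also have "cis (- \<gamma>) * cis (- \<alpha>/2) * cis (pi/2) * cis \<beta> = cis (pi/2 - (\<gamma> + \<alpha>/2 - \<beta>))"
    unfolding cis_mult by (rule arg_cong[where f = cis]) simp
  finally have "Im (cis (- \<gamma>) * ((cis (- \<alpha>) - 1) * (C1 - C0))) = - 2 * r * sin (\<alpha>/2) * sin (pi/2 - (\<gamma> + \<alpha>/2 - \<beta>))"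
    by simp
  also have "sin (pi/2 - (\<gamma> + \<alpha>/2 - \<beta>)) = cos (\<gamma> + \<alpha>/2 - \<beta>)" by (simp add: cos_sin_eq)
  finally show ?thesis by (simp add: rot_gap_def r_def \<beta>_def right_diff_distrib)
qed

theorem theorem23:
  fixes a \<alpha> \<gamma> \<Delta> N :: real and C0 C1 :: complex and T :: "complex \<Rightarrow> complex"
    and q :: "nat \<Rightarrow> real" and l0 :: nat
  assumes "piecewise_rotation \<alpha> \<gamma> C0 C1 T"
    and "\<alpha> = 2 * pi * a"
    and "a \<notin> \<rat>"
    and "\<not> bij T"
    and "\<Delta> = rot_gap \<alpha> \<gamma> C0 C1"
    and "N = radial_disp T"
    and "\<And>l. q l = of_int (cf_den a l)"
    and "1 / q l0 * ((8 + pi / (2 * q l0)) * N + 4 * \<bar>\<Delta>\<bar>) < \<bar>\<Delta>\<bar> / pi"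
  shows "threshold_radius T \<le> ereal (q l0 * N * (2 / pi * q l0 + 1))"
proof -
  define p where "p = cf_num a l0"
  define Q where "Q = nat (cf_den a l0)"
  note cf = cf_approx[OF assms(3), of l0]
  have Q: "int Q = cf_den a l0" "real Q = q l0" "0 < Q" using cf(1) by (auto simp: Q_def assms(7))
  define u0 u1 where "u0 = (cis (- \<alpha>) - 1) * C0" and "u1 = (cis (- \<alpha>) - 1) * C1"
  have u: "norm u0 \<le> N" "norm u1 \<le> N"
    using displacement_le_radial_disp[OF assms(1)] by (simp_all add: u0_def u1_def assms(6))
  \<comment> \<open>Distinct centres are not both 0, so some translation is nonzero and
    \<open>N\<close> is positive.\<close>
  have "cis (- \<alpha>) \<noteq> 1" "C0 \<noteq> 0 \<or> C1 \<noteq> 0"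
  proof -
    have "cis \<alpha> \<noteq> 1" using assms(1) by (simp add: piecewise_rotation_def)
    then show "cis (- \<alpha>) \<noteq> 1" by (metis cis_inverse inverse_1 inverse_eq_iff_eq)
  qed (use assms(1) in \<open>auto simp: piecewise_rotation_def\<close>)
  then have "u0 \<noteq> 0 \<or> u1 \<noteq> 0" by (simp add: u0_def u1_def)
  then have N: "0 < N" using u by (metis norm_le_zero_iff not_le order_trans)
  interpret rotation_orbit T \<alpha> \<gamma> u0 u1 N p Q \<Delta>
  proof
    show "T z = cis \<alpha> * (z + (if z \<in> upper_half \<gamma> then u0 else u1))" for z
      using assms(1) by (simp add: piecewise_rotation_def pw_rot_def u0_def u1_def algebra_simps cis_mult)
    show "\<bar>\<alpha> / (2 * pi) - of_int p / real Q\<bar> \<le> 1 / (real Q)\<^sup>2"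
      using cf(3) by (simp add: Q(2) assms(2,7) p_def)
    show "\<Delta> = Im (cis (- \<gamma>) * (u1 - u0))" by (simp add: assms(5) rot_gap_eq u0_def u1_def)
    show "(8 + pi / (2 * real Q)) * N + 4 * \<bar>\<Delta>\<bar> < real Q * \<bar>\<Delta>\<bar> / pi"
    proof -
      have "0 < q l0" using Q by (metis of_nat_0_less_iff)
      then have "q l0 * (1 / q l0 * ((8 + pi / (2 * q l0)) * N + 4 * \<bar>\<Delta>\<bar>)) < q l0 * (\<bar>\<Delta>\<bar> / pi)"
        using assms(8) by (intro mult_strict_left_mono)
      then show ?thesis using \<open>0 < q l0\<close> by (simp add: Q(2))
    qed
  qed (use u N cf(2) Q in \<open>auto simp: p_def\<close>)
  have "R = q l0 * N * (2 / pi * q l0 + 1)"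
    by (simp add: R_def R0_def Q(2) power2_eq_square algebra_simps)
  then show ?thesis using threshold_le by simp
qed

end
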